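(* Let $r\ge 1$ be an integer. Up to isomorphism there is a unique tree with passport $[r^2,1^{4r-3};3^{2r-1}]$, and its monodromy group $G$ satisfies $$G\cong\begin{cases}A_{2r-1}\wr\mathbb{Z}_3 & \text{if } r\text{ is odd},\\ R_3 & \text{if } r\text{ is even}.\end{cases}$$
   Context: A dessin is a connected bicolored (black/white, every edge joining a black and a white vertex) graph with a cyclic (counterclockwise) ordering of the edges around each vertex; here all dessins are finite trees, and an isomorphism is a graph isomorphism preserving colors and cyclic orderings. The passport of a dessin is the pair of lists $[b_1,\dots,b_k;w_1,\dots,w_\ell]$ of degrees of the black vertices and of the white vertices (multisets); within a list, $a^m$ denotes $m$ vertices of degree $a$. Label the edges of a dessin $1,\dots,n$. Let $\sigma_0\in S_n$ (resp. $\sigma_1\in S_n$) be the product of the cycles given by the cyclic orders of the edges around the black (resp. white) vertices. The monodromy group of the dessin is $\langle\sigma_0,\sigma_1\rangle\le S_n$ (independent of the labeling up to conjugacy). For a group $H$, the wreath product $H\wr\mathbb{Z}_3$ is the semidirect product $H^3\rtimes\mathbb{Z}_3$ with $\mathbb{Z}_3$ acting by cyclically permuting the three factors; its elements are written $(h_1,h_2,h_3,g)$. $S_m$ and $A_m$ are the symmetric and alternating groups. $R_3$ denotes the index $2$ subgroup of $S_{2r-1}\wr\mathbb{Z}_3$ consisting of all $(\tau_1,\tau_2,\tau_3,g)$ such that $\tau_1\tau_2\tau_3$ is an even permutation (the tree has $n=6r-3$ edges, so $2r-1=n/3$). *)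

theory Defs
  imports "HOL-Algebra.Sym_Groups" "HOL-Algebra.Elementary_Groups"
    "HOL-Combinatorics.Orbits" "HOL-Library.Multiset"
begin

section \<open>Dessins\<close>

text \<open>Edges are abstract, each with a black and a white end, so parallel edges are not
excluded a priori. The function \<open>rot D v\<close> sends an edge at \<open>v\<close> to its counterclockwise successor
around \<open>v\<close>; its values on edges not incident to \<open>v\<close> are irrelevant.\<close>

record ('v, 'e) dessin =
  black :: "'v set"
  white :: "'v set"
  edges :: "'e set"
  bend :: "'e \<Rightarrow> 'v"
  wend :: "'e \<Rightarrow> 'v"
  rot :: "'v \<Rightarrow> 'e \<Rightarrow> 'e"

definition vertices :: "('v, 'e) dessin \<Rightarrow> 'v set" where
  "vertices D = black D \<union> white D"

definition joins :: "('v, 'e) dessin \<Rightarrow> 'e \<Rightarrow> 'v \<Rightarrow> 'v \<Rightarrow> bool" where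
  "joins D e u v \<longleftrightarrow> e \<in> edges D \<and> {u, v} = {bend D e, wend D e}"

definition edges_at :: "('v, 'e) dessin \<Rightarrow> 'v \<Rightarrow> 'e set" where
  "edges_at D v = {e \<in> edges D. bend D e = v \<or> wend D e = v}"

definition deg :: "('v, 'e) dessin \<Rightarrow> 'v \<Rightarrow> nat" where
  "deg D v = card (edges_at D v)"

definition graph_connected :: "('v, 'e) dessin \<Rightarrow> bool" where
  "graph_connected D \<longleftrightarrow> vertices D \<noteq> {} \<and>
     (\<forall>u \<in> vertices D. \<forall>v \<in> vertices D. (\<lambda>x y. \<exists>e. joins D e x y)\<^sup>*\<^sup>* u v)"

text \<open>The guard on \<open>cyclic_on\<close>, which fails for the empty set, only concerns isolated vertices,
hence (by connectedness) the dessin with a single vertex.\<close>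

definition is_dessin :: "('v, 'e) dessin \<Rightarrow> bool" where
  "is_dessin D \<longleftrightarrow>
     finite (vertices D) \<and> finite (edges D) \<and> black D \<inter> white D = {} \<and>
     (\<forall>e \<in> edges D. bend D e \<in> black D \<and> wend D e \<in> white D) \<and>
     graph_connected D \<and>
     (\<forall>v \<in> vertices D. edges_at D v \<noteq> {} \<longrightarrow> cyclic_on (rot D v) (edges_at D v))"

definition graph_cycle :: "('v, 'e) dessin \<Rightarrow> 'v list \<Rightarrow> 'e list \<Rightarrow> bool" where
  "graph_cycle D vs es \<longleftrightarrow>
     es \<noteq> [] \<and> length vs = length es \<and> distinct vs \<and> distinct es \<and>
     (\<forall>i < length es. joins D (es ! i) (vs ! i) (vs ! (Suc i mod length es)))"

definition is_tree_dessin :: "('v, 'e) dessin \<Rightarrow> bool" where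
  "is_tree_dessin D \<longleftrightarrow> is_dessin D \<and> \<not> (\<exists>vs es. graph_cycle D vs es)"

definition isomorphic :: "('v, 'e) dessin \<Rightarrow> ('w, 'f) dessin \<Rightarrow> bool" where
  "isomorphic D D' \<longleftrightarrow> (\<exists>f g.
     bij_betw f (black D) (black D') \<and> bij_betw f (white D) (white D') \<and>
     bij_betw g (edges D) (edges D') \<and>
     (\<forall>e \<in> edges D. bend D' (g e) = f (bend D e) \<and> wend D' (g e) = f (wend D e)) \<and>
     (\<forall>v \<in> vertices D. \<forall>e \<in> edges_at D v. g (rot D v e) = rot D' (f v) (g e)))"

definition passport :: "('v, 'e) dessin \<Rightarrow> nat multiset \<times> nat multiset" where
  "passport D =
     (image_mset (deg D) (mset_set (black D)), image_mset (deg D) (mset_set (white D)))"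

section \<open>Monodromy groups\<close>

definition labelling :: "('v, 'e) dessin \<Rightarrow> ('e \<Rightarrow> nat) \<Rightarrow> bool" where
  "labelling D l \<longleftrightarrow> bij_betw l (edges D) {1..card (edges D)}"

text \<open>Every edge lies in exactly one cycle around a black vertex, so the product of these disjoint
cycles moves an edge to its successor around its black end; likewise for white.\<close>

definition sigma0 :: "('v, 'e) dessin \<Rightarrow> ('e \<Rightarrow> nat) \<Rightarrow> nat \<Rightarrow> nat" where
  "sigma0 D l i =
     (if i \<in> {1..card (edges D)}
      then let e = inv_into (edges D) l i in l (rot D (bend D e) e) else i)"

definition sigma1 :: "('v, 'e) dessin \<Rightarrow> ('e \<Rightarrow> nat) \<Rightarrow> nat \<Rightarrow> nat" where
  "sigma1 D l i =
     (if i \<in> {1..card (edges D)}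
      then let e = inv_into (edges D) l i in l (rot D (wend D e) e) else i)"

definition monodromy_group :: "('v, 'e) dessin \<Rightarrow> ('e \<Rightarrow> nat) \<Rightarrow> (nat \<Rightarrow> nat) monoid" where
  "monodromy_group D l = (let S = sym_group (card (edges D)) in
     S\<lparr>carrier := generate S {sigma0 D l, sigma1 D l}\<rparr>)"

section \<open>Wreath products with the cyclic group of order three\<close>

definition semidirect ::
    "('a, 'm) monoid_scheme \<Rightarrow> ('b, 'n) monoid_scheme \<Rightarrow> ('b \<Rightarrow> 'a \<Rightarrow> 'a) \<Rightarrow> ('a \<times> 'b) monoid" where
  "semidirect N K \<phi> =
     \<lparr>carrier = carrier N \<times> carrier K,
      mult = (\<lambda>(n, k) (n', k'). (n \<otimes>\<^bsub>N\<^esub> \<phi> k n', k \<otimes>\<^bsub>K\<^esub> k')),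
      one = (\<one>\<^bsub>N\<^esub>, \<one>\<^bsub>K\<^esub>)\<rparr>"

fun shift3 :: "'a \<times> 'a \<times> 'a \<Rightarrow> 'a \<times> 'a \<times> 'a" where
  "shift3 (a, b, c) = (c, a, b)"

text \<open>\<open>integer_mod_group 3\<close> has carrier \<open>{0, 1, 2}\<close>, so \<open>nat g\<close> is the representative of \<open>g\<close>.\<close>

definition wreath_Z3 :: "'a monoid \<Rightarrow> (('a \<times> 'a \<times> 'a) \<times> int) monoid" where
  "wreath_Z3 H = semidirect (H \<times>\<times> H \<times>\<times> H) (integer_mod_group 3) (\<lambda>g. shift3 ^^ nat g)"

definition R3 :: "nat \<Rightarrow> (((nat \<Rightarrow> nat) \<times> (nat \<Rightarrow> nat) \<times> (nat \<Rightarrow> nat)) \<times> int) monoid" where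
  "R3 r = (let W = wreath_Z3 (sym_group (2 * r - 1)) in
     W\<lparr>carrier := {((t1, t2, t3), g) | t1 t2 t3 g.
         ((t1, t2, t3), g) \<in> carrier W \<and> evenperm (t1 \<circ> t2 \<circ> t3)}\<rparr>)"

end

theory Submission
  imports Defs
begin

text \<open>
A tree with this passport can be drawn as follows. All black vertices are leaves except two of degree
\<open>r\<close> (if \<open>r \<ge> 2\<close>), so by connectedness these two have a common white neighbour, the centre. Since there
are no cycles, this neighbour is unique, there are no parallel edges, and the \<open>2r - 1\<close> white neighbours
of the two black vertices are distinct; by counting there are no other white vertices. Each of them has
degree three, and all remaining edges end in black leaves. The only choice left, the cyclic order at the
centre, is absorbed by exchanging the two black vertices.

Colour the edges by the elements of \<open>\<int>/3\<close> so that the rotation \<open>\<sigma>\<^sub>1\<close> around the white vertices adds 1,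
the edges at the first black vertex of degree \<open>r\<close> have colour 0 and those at the second one have
colour 1; for \<open>r = 1\<close> these are two of the three leaves, the second following the first.
Numbering the white vertices by \<open>1, \<dots>, 2r - 1\<close> along the two rotations, with the centre at \<open>r\<close>, gives
coordinates \<open>(c, i)\<close> on the edges in which the rotations are the elements \<open>\<sigma>\<^sub>0 = (a, b, id; 0)\<close> and
\<open>\<sigma>\<^sub>1 = (id, id, id; 1)\<close> of the wreath product \<open>S\<^bsub>2r-1\<^esub> \<wr> \<int>/3\<close>, with \<open>r\<close>-cycles \<open>a\<close> and \<open>b\<close> that share
exactly the point \<open>r\<close> (\<open>passport_tree.edge_coordinates_exist\<close>). Since a bijection of the edges that
commutes with both rotations is an isomorphism of dessins, the tree is unique. Existence is a direct
verification for the dessin with these rotations (\<open>standard_tree\<close>).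

The monodromy group is the subgroup generated by the two elements. Conjugation by \<open>\<sigma>\<^sub>1\<close> permutes the three
factors cyclically, so the group also contains \<open>(id, a, b; 0)\<close>, and the commutator of this element with
\<open>\<sigma>\<^sub>0\<close> is \<open>(id, aba\<^sup>-\<^sup>1b\<^sup>-\<^sup>1, id; 0)\<close>. For \<open>r \<ge> 2\<close> the middle component is a 3-cycle, and its conjugates under
\<open>\<langle>a, b\<rangle>\<close> generate the alternating group (\<open>even_permutations_from_two_cycles\<close>). Thus the group contains
all triples of even permutations. If \<open>r\<close> is odd, then \<open>a\<close> and \<open>b\<close> are even and there is nothing else
besides the rotations; if \<open>r\<close> is even, then \<open>(a, b, id; 0)\<close> and its rotations reach precisely the triples
with even product.
\<close>

section \<open>Two cycles that share one point\<close>

lemma cycle_of_list_nth: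
  assumes "distinct cs" "k < length cs"
  shows "cycle_of_list cs (cs ! k) = cs ! (Suc k mod length cs)"
proof -
  have "map (cycle_of_list cs) cs = rotate1 cs"
    using cyclic_rotation[OF assms(1), of 1] by simp
  then have "cycle_of_list cs (cs ! k) = rotate1 cs ! k"
    using assms(2) by (metis nth_map)
  then show ?thesis using assms(2) by (simp add: nth_rotate1)
qed

lemma evenperm_cycle_of_list:
  assumes "distinct cs" "cs \<noteq> []"
  shows "evenperm (cycle_of_list cs) \<longleftrightarrow> odd (length cs)"
proof -
  have "swapidseq (length cs - 1) (cycle_of_list cs)"
    using swapidseq_ext_imp_swapidseq swapidseq_ext_of_cycles assms(1) by blast
  then have "evenperm (cycle_of_list cs) = even (length cs - 1)"
    by (rule evenperm_unique) simp
  then show ?thesis using assms(2) by (cases cs) auto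
qed

text \<open>On the points \<open>1, \<dots>, 2r - 1\<close>, \<open>right_cycle r\<close> is the cycle
\<open>(r, r + 1, \<dots>, 2r - 1)\<close> and \<open>left_cycle r\<close> is the cycle \<open>(r, r - 1, \<dots>, 1)\<close>. Both have length
\<open>r\<close>, and \<open>r\<close> is their only common point. Both are the identity off their supports; for \<open>r = 1\<close> both are
the identity.\<close>

definition right_cycle :: "nat \<Rightarrow> nat \<Rightarrow> nat" where
  "right_cycle r i = (if r \<le> i \<and> i < 2 * r - 1 then i + 1 else if i = 2 * r - 1 then r else i)"

definition left_cycle :: "nat \<Rightarrow> nat \<Rightarrow> nat" where
  "left_cycle r i = (if 1 < i \<and> i \<le> r then i - 1 else if i = 1 then r else i)"

lemma right_cycle_eq_cycle_of_list:
  assumes "r \<ge> 1"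
  shows "right_cycle r = cycle_of_list [r..<2 * r]"
proof
  fix x
  show "right_cycle r x = cycle_of_list [r..<2 * r] x"
  proof (cases "x \<in> {r..<2 * r}")
    case True
    then have "[r..<2 * r] ! (x - r) = x" by simp
    then have "cycle_of_list [r..<2 * r] x = [r..<2 * r] ! (Suc (x - r) mod r)"
      using cycle_of_list_nth[of "[r..<2 * r]" "x - r"] True by auto
    also have "\<dots> = right_cycle r x"
    proof (cases "x = 2 * r - 1")
      case True
      then have "Suc (x - r) = r" using assms by simp
      then show ?thesis using True assms by (simp add: right_cycle_def)
    next
      case False
      then have "Suc (x - r) < r" using \<open>x \<in> {r..<2 * r}\<close> by auto
      then show ?thesis using False \<open>x \<in> {r..<2 * r}\<close> by (auto simp: right_cycle_def)
    qed
    finally show ?thesis by simp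
  next
    case False
    then show ?thesis using assms by (subst id_outside_supp) (auto simp: right_cycle_def)
  qed
qed

lemma left_cycle_eq_cycle_of_list:
  assumes "r \<ge> 1"
  shows "left_cycle r = cycle_of_list (rev [1..<r + 1])"
proof
  fix x
  let ?cs = "rev [1..<r + 1]"
  have nth: "?cs ! k = r - k" if "k < r" for k
    using that by (simp add: rev_nth del: upt_Suc)
  show "left_cycle r x = cycle_of_list ?cs x"
  proof (cases "x \<in> {1..r}")
    case True
    then have "?cs ! (r - x) = x" using nth[of "r - x"] by auto
    then have "cycle_of_list ?cs x = ?cs ! (Suc (r - x) mod r)"
      using cycle_of_list_nth[of ?cs "r - x"] True by auto
    also have "\<dots> = left_cycle r x"
    proof (cases "x = 1")
      case True
      then have "Suc (r - x) = r" using assms by simp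
      then show ?thesis using True assms nth[of 0] by (simp add: left_cycle_def)
    next
      case False
      then have "Suc (r - x) < r" using \<open>x \<in> {1..r}\<close> by auto
      then show ?thesis using False \<open>x \<in> {1..r}\<close> nth[of "Suc (r - x)"]
        by (auto simp: left_cycle_def)
    qed
    finally show ?thesis by simp
  next
    case False
    then show ?thesis using assms by (subst id_outside_supp) (auto simp: left_cycle_def)
  qed
qed

lemma right_cycle_permutes:
  assumes "r \<ge> 1" shows "right_cycle r permutes {1..2 * r - 1}"
proof -
  have "set [r..<2 * r] \<subseteq> {1..2 * r - 1}" using assms by auto
  from permutes_subset[OF cycle_permutes this] show ?thesis
    using assms by (simp add: right_cycle_eq_cycle_of_list)
qed

lemma bij_right_cycle: "r \<ge> 1 \<Longrightarrow> bij (right_cycle r)"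
  using right_cycle_permutes permutes_bij by blast

lemma left_cycle_permutes:
  assumes "r \<ge> 1" shows "left_cycle r permutes {1..2 * r - 1}"
proof -
  have "set (rev [1..<r + 1]) \<subseteq> {1..2 * r - 1}" using assms by auto
  from permutes_subset[OF cycle_permutes this] show ?thesis
    using assms by (simp add: left_cycle_eq_cycle_of_list del: upt_Suc)
qed

lemma bij_left_cycle: "r \<ge> 1 \<Longrightarrow> bij (left_cycle r)"
  using left_cycle_permutes permutes_bij by blast

lemma evenperm_right_cycle:
  assumes "r \<ge> 1" shows "evenperm (right_cycle r) \<longleftrightarrow> odd r"
  using evenperm_cycle_of_list[of "[r..<2 * r]"] assms
  by (simp add: right_cycle_eq_cycle_of_list)

lemma evenperm_left_cycle:
  assumes "r \<ge> 1" shows "evenperm (left_cycle r) \<longleftrightarrow> odd r"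
  using evenperm_cycle_of_list[of "rev [1..<r + 1]"] assms
  by (simp add: left_cycle_eq_cycle_of_list del: upt_Suc)

lemma commutator_of_cycles:
  assumes "r \<ge> 2"
  shows "right_cycle r \<circ> left_cycle r \<circ> inv' (right_cycle r) \<circ> inv' (left_cycle r) =
    cycle_of_list [r, r + 1, r - 1]"
proof -
  let ?a = "right_cycle r" and ?b = "left_cycle r"
  have bij: "bij ?a" "bij ?b"
    using assms bij_right_cycle bij_left_cycle by auto
  have "?a \<circ> ?b = cycle_of_list [r, r + 1, r - 1] \<circ> (?b \<circ> ?a)"
  proof
    fix x
    let ?c = "cycle_of_list [r, r + 1, r - 1]"
    have c: "?c r = r + 1" "?c (r + 1) = r - 1" "?c (r - 1) = r"
      "\<And>y. y \<notin> {r, r + 1, r - 1} \<Longrightarrow> ?c y = y"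
      using assms by (auto simp: transpose_def)
    consider "x = r" | "x = 2 * r - 1" | "r < x" "x < 2 * r - 1" | "x = 1" | "1 < x" "x < r"
      | "x = 0" | "2 * r - 1 < x"
      by linarith
    then show "(?a \<circ> ?b) x = (?c \<circ> (?b \<circ> ?a)) x"
    proof cases
      case 3
      then have "?c (x + 1) = x + 1" using assms by (intro c(4)) auto
      then show ?thesis using assms 3 by (auto simp: right_cycle_def left_cycle_def simp del: cycle_of_list.simps)
    next
      case 5
      then have "?c (x - 1) = x - 1" using assms by (intro c(4)) auto
      then show ?thesis using assms 5 by (auto simp: right_cycle_def left_cycle_def simp del: cycle_of_list.simps)
    next
      case 7
      then have "?c x = x" using assms by (intro c(4)) auto
      then show ?thesis using assms 7 by (auto simp: right_cycle_def left_cycle_def simp del: cycle_of_list.simps)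
    next
      case 6
      have "?c x = x" using assms 6 by (intro c(4)) auto
      then show ?thesis using assms 6 by (auto simp: right_cycle_def left_cycle_def simp del: cycle_of_list.simps)
    qed (use assms c(1-3) in \<open>auto simp: right_cycle_def left_cycle_def simp del: cycle_of_list.simps\<close>)
  qed
  then have "?a \<circ> ?b \<circ> inv' ?a \<circ> inv' ?b =
      cycle_of_list [r, r + 1, r - 1] \<circ> (?b \<circ> (?a \<circ> inv' ?a) \<circ> inv' ?b)"
    by (simp only: o_assoc)
  moreover have "?a \<circ> inv' ?a = id" "?b \<circ> inv' ?b = id"
    using bij by (auto dest: bij_is_surj simp flip: surj_iff)
  ultimately show ?thesis by (simp only: comp_id id_comp)
qed

lemma cycle_of_list_rotate3:
  "distinct [x, y, z] \<Longrightarrow> cycle_of_list [y, z, x] = cycle_of_list [x, y, z]"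
  using cycle_of_list_rotate_independent[of "[x, y, z]" 1] by simp

lemma cycle_of_list_square3:
  "distinct [x, y, z] \<Longrightarrow> cycle_of_list [x, y, z] \<circ> cycle_of_list [x, y, z] = cycle_of_list [x, z, y]"
  by (auto simp: fun_eq_iff transpose_def)

text \<open>A set of permutations that is closed under the group operations and normalized by the two
cycles contains all even permutations of \<open>1, \<dots>, 2r - 1\<close> as soon as it contains the commutator of the
cycles. For \<open>r \<ge> 2\<close> the commutator is a 3-cycle; its conjugates under the two cycles, glued along
common pairs of points, give every 3-cycle.\<close>

lemma even_permutations_from_two_cycles:
  fixes K :: "(nat \<Rightarrow> nat) set"
  assumes r: "r \<ge> 1"
    and id: "id \<in> K"
    and comp: "\<And>p q. p \<in> K \<Longrightarrow> q \<in> K \<Longrightarrow> p \<circ> q \<in> K"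
    and inv: "\<And>p. p \<in> K \<Longrightarrow> inv' p \<in> K"
    and conj_right: "\<And>p. p \<in> K \<Longrightarrow> right_cycle r \<circ> p \<circ> inv' (right_cycle r) \<in> K"
    and conj_left: "\<And>p. p \<in> K \<Longrightarrow> left_cycle r \<circ> p \<circ> inv' (left_cycle r) \<in> K"
    and commutator: "right_cycle r \<circ> left_cycle r \<circ> inv' (right_cycle r) \<circ> inv' (left_cycle r) \<in> K"
    and p: "p permutes {1..2 * r - 1}" "evenperm p"
  shows "p \<in> K"
proof -
  let ?n = "2 * r - 1"
  define R where "R x y z \<longleftrightarrow> distinct [x, y, z] \<and> cycle_of_list [x, y, z] \<in> K" for x y z
  have rot: "R y z x" if "R x y z" for x y z
    using that cycle_of_list_rotate3[of x y z] unfolding R_def by auto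
  have swap: "R x z y" if "R x y z" for x y z
    using that comp[of "cycle_of_list [x, y, z]" "cycle_of_list [x, y, z]"]
      cycle_of_list_square3[of x y z] unfolding R_def by auto
  have conj: "R (f x) (f y) (f z)"
    if "R x y z" "bij f" "f \<circ> cycle_of_list [x, y, z] \<circ> inv' f \<in> K" for f x y z
    using that conjugation_of_cycle[of "[x, y, z]" f] unfolding R_def
    by (auto simp: bij_def inj_def)
  \<comment> \<open>Two 3-cycles with two common points generate all 3-cycles on their four points; the one needed
    here comes from conjugating twice.\<close>
  have glue: "R x p q" if "R x y p" "R x y q" "p \<noteq> q" for x y p q
  proof -
    let ?f = "cycle_of_list [x, y, p]"
    have "bij ?f" using cycle_permutes permutes_bij by blast
    then have "R (?f x) (?f y) (?f q)"
      using that comp inv by (intro conj[of x y q ?f]) (auto simp: R_def simp del: cycle_of_list.simps)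
    moreover have "?f x = y" "?f y = p" "?f q = q"
      using that by (auto simp: R_def transpose_def)
    ultimately have "R y p q" by simp
    then have "R p q y" by (rule rot)
    moreover have "R p x y" using that(1) rot by blast
    ultimately have *: "R y p q" "R y p x" using rot swap by blast+
    let ?g = "cycle_of_list [y, p, q]"
    have "bij ?g" using cycle_permutes permutes_bij by blast
    then have "R (?g y) (?g p) (?g x)"
      using * comp inv by (intro conj[of y p x ?g]) (auto simp: R_def simp del: cycle_of_list.simps)
    moreover have "?g y = p" "?g p = q" "?g x = x"
      using * that by (auto simp: R_def transpose_def)
    ultimately show ?thesis using rot by metis
  qed
  have three: "R x y z" if r2: "r \<ge> 2" and xyz: "{x, y, z} \<subseteq> {1..?n}" "distinct [x, y, z]" for x y z
  proof -
    have bij: "bij (right_cycle r)" "bij (left_cycle r)"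
      using r bij_right_cycle bij_left_cycle by auto
    have base: "R r (r + 1) (r - 1)"
      using commutator r2 unfolding commutator_of_cycles[OF r2] R_def by auto
    \<comment> \<open>Conjugation by one cycle moves two of the three points of \<open>base\<close> and fixes the third.\<close>
    have right: "R (r + i) (r + i + 1) (r - 1)" if "i + 1 < r" for i
      using that
    proof (induction i)
      case 0
      show ?case using base by simp
    next
      case (Suc i)
      then have "R (r + i) (r + i + 1) (r - 1)" by simp
      from conj[OF this bij(1)] conj_right this
      have "R (right_cycle r (r + i)) (right_cycle r (r + i + 1)) (right_cycle r (r - 1))"
        unfolding R_def by blast
      moreover have "right_cycle r (r + i) = r + i + 1" "right_cycle r (r + i + 1) = r + i + 2"
        "right_cycle r (r - 1) = r - 1"
        using Suc.prems by (auto simp: right_cycle_def)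
      ultimately show ?case by simp
    qed
    have left: "R (r - i) (r - (i + 1)) (r + 1)" if "i + 1 < r" for i
      using that
    proof (induction i)
      case 0
      show ?case using swap[OF base] by simp
    next
      case (Suc i)
      then have "R (r - i) (r - (i + 1)) (r + 1)" by simp
      from conj[OF this bij(2)] conj_left this
      have "R (left_cycle r (r - i)) (left_cycle r (r - (i + 1))) (left_cycle r (r + 1))"
        unfolding R_def by blast
      moreover have "left_cycle r (r - i) = r - (i + 1)" "left_cycle r (r - (i + 1)) = r - (i + 2)"
        "left_cycle r (r + 1) = r + 1"
        using Suc.prems by (auto simp: left_cycle_def)
      ultimately show ?case by simp
    qed
    have right0: "R r (r + i) (r - 1)" if "1 \<le> i" "i < r" for i
      using that
    proof (induction i rule: dec_induct)
      case base
      show ?case using right[of 0] r2 by simp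
    next
      case (step i)
      then have "R r (r + i) (r - 1)" "R (r + i) (r + i + 1) (r - 1)" using right by simp_all
      then have "R (r + i) (r - 1) r" "R (r + i) (r - 1) (r + i + 1)" using rot swap by blast+
      then have "R (r - 1) (r + i) r" "R (r - 1) (r + i) (r + i + 1)" using rot swap by blast+
      then have "R (r - 1) r (r + i + 1)" using glue[of "r - 1" "r + i" r "r + i + 1"] step by simp
      then show ?case using rot by (metis add_Suc_right Suc_eq_plus1)
    qed
    have left0: "R r (r - i) (r + 1)" if "1 \<le> i" "i < r" for i
      using that
    proof (induction i rule: dec_induct)
      case base
      show ?case using left[of 0] r2 by simp
    next
      case (step i)
      then have "R r (r - i) (r + 1)" "R (r - i) (r - (i + 1)) (r + 1)" using left by simp_all
      then have "R (r + 1) (r - i) r" "R (r + 1) (r - i) (r - (i + 1))" using rot swap by blast+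
      then have "R (r + 1) r (r - (i + 1))"
        using glue[of "r + 1" "r - i" r "r - (i + 1)"] step by simp
      then show ?case using rot by (metis add_Suc_right Suc_eq_plus1 add_0_right)
    qed
    have through: "R r (r + 1) u" if "u \<in> {1..?n}" "u \<noteq> r" "u \<noteq> r + 1" for u
    proof (cases "u < r")
      case True
      then have "R r u (r + 1)" using left0[of "r - u"] that by simp
      then show ?thesis by (rule swap)
    next
      case False
      then have "r + (u - r) = u" "1 \<le> u - r" "u - r < r" using that by auto
      then have "R r u (r - 1)" using right0[of "u - r"] by metis
      then have "R r (r - 1) u" by (rule swap)
      moreover have "R r (r - 1) (r + 1)" using base swap by blast
      ultimately show ?thesis using glue[of r "r - 1" "r + 1" u] that by simp
    qed
    have center: "R r u v" if "u \<in> {1..?n}" "v \<in> {1..?n}" "distinct [r, u, v]" for u v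
    proof (cases "u = r + 1 \<or> v = r + 1")
      case True
      then show ?thesis using through[of u] through[of v] swap[of r "r + 1" u] that by auto
    next
      case False
      then show ?thesis using glue[of r "r + 1" u v] through[of u] through[of v] that by auto
    qed
    show ?thesis
    proof (cases "r \<in> {x, y, z}")
      case True
      then show ?thesis using center[of y z] center[of z x] center[of x y] xyz
          rot[of y z x] rot[of z x y] by auto
    next
      case False
      then have "R r x y" "R r x z" using center[of x y] center[of x z] xyz by auto
      then have "R x r y" "R x r z" using rot swap by blast+
      then show ?thesis using glue[of x r y z] xyz by simp
    qed
  qed
  have "three_cycles ?n \<subseteq> K"
  proof
    fix c assume "c \<in> three_cycles ?n"
    then obtain cs where cs: "c = cycle_of_list cs" "distinct cs" "length cs = 3" "set cs \<subseteq> {1..?n}"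
      by auto
    then obtain x y z where xyz: "cs = [x, y, z]"
      by (auto simp: length_Suc_conv numeral_3_eq_3)
    have "r \<ge> 2"
    proof (rule ccontr)
      assume "\<not> r \<ge> 2"
      then have "x = 1" "y = 1" using xyz cs(4) r by auto
      then show False using cs(2) xyz by simp
    qed
    then show "c \<in> K" using three[of x y z] cs xyz by (simp add: R_def)
  qed
  moreover have "p \<in> generate (alt_group ?n) (three_cycles ?n)"
    using p alt_group_carrier alt_group_carrier_as_three_cycles by blast
  moreover have "h \<in> K" if "h \<in> generate (alt_group ?n) H" "H \<subseteq> K" "H \<subseteq> carrier (alt_group ?n)" for h H
    using that
  proof (induction rule: generate.induct)
    case one
    show ?case unfolding alt_group_one by (rule id)
  next
    case (incl h)
    then show ?case by blast
  next
    case (inv h)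
    then have "inv\<^bsub>alt_group ?n\<^esub> h = inv' h" by (intro alt_group_inv_equality) blast
    then show ?case using inv assms(4) by auto
  next
    case (eng h1 h2)
    then show ?case unfolding alt_group_mult by (intro comp)
  qed
  ultimately show ?thesis using three_cycles_incl by blast
qed

section \<open>The subgroup of the wreath product generated by the two rotations\<close>

lemma carrier_wreath_Z3:
  "carrier (wreath_Z3 H) = (carrier H \<times> carrier H \<times> carrier H) \<times> {0, 1, 2}"
  by (auto simp: wreath_Z3_def semidirect_def carrier_integer_mod_group)

lemma one_wreath_Z3: "\<one>\<^bsub>wreath_Z3 H\<^esub> = ((\<one>\<^bsub>H\<^esub>, \<one>\<^bsub>H\<^esub>, \<one>\<^bsub>H\<^esub>), 0)"
  by (simp add: wreath_Z3_def semidirect_def)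

lemma mult_wreath_Z3:
  "((a, b, c), 0) \<otimes>\<^bsub>wreath_Z3 H\<^esub> ((a', b', c'), h) =
    ((a \<otimes>\<^bsub>H\<^esub> a', b \<otimes>\<^bsub>H\<^esub> b', c \<otimes>\<^bsub>H\<^esub> c'), h mod 3)"
  "((a, b, c), 1) \<otimes>\<^bsub>wreath_Z3 H\<^esub> ((a', b', c'), h) =
    ((a \<otimes>\<^bsub>H\<^esub> c', b \<otimes>\<^bsub>H\<^esub> a', c \<otimes>\<^bsub>H\<^esub> b'), (1 + h) mod 3)"
  "((a, b, c), 2) \<otimes>\<^bsub>wreath_Z3 H\<^esub> ((a', b', c'), h) =
    ((a \<otimes>\<^bsub>H\<^esub> b', b \<otimes>\<^bsub>H\<^esub> c', c \<otimes>\<^bsub>H\<^esub> a'), (2 + h) mod 3)"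
  by (simp_all add: wreath_Z3_def semidirect_def numeral_2_eq_2)

lemma group_wreath_Z3:
  assumes "group H" shows "group (wreath_Z3 H)"
proof -
  interpret H: group H by fact
  note [simp] = carrier_wreath_Z3 one_wreath_Z3 mult_wreath_Z3
  show ?thesis
  proof (rule groupI)
    fix x y assume "x \<in> carrier (wreath_Z3 H)" "y \<in> carrier (wreath_Z3 H)"
    then show "x \<otimes>\<^bsub>wreath_Z3 H\<^esub> y \<in> carrier (wreath_Z3 H)"
      by auto
  next
    show "\<one>\<^bsub>wreath_Z3 H\<^esub> \<in> carrier (wreath_Z3 H)" by simp
  next
    fix x y z
    assume "x \<in> carrier (wreath_Z3 H)" "y \<in> carrier (wreath_Z3 H)" "z \<in> carrier (wreath_Z3 H)"
    then show "x \<otimes>\<^bsub>wreath_Z3 H\<^esub> y \<otimes>\<^bsub>wreath_Z3 H\<^esub> z = x \<otimes>\<^bsub>wreath_Z3 H\<^esub> (y \<otimes>\<^bsub>wreath_Z3 H\<^esub> z)"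
      by (auto simp: H.m_assoc)
  next
    fix x assume "x \<in> carrier (wreath_Z3 H)"
    then show "\<one>\<^bsub>wreath_Z3 H\<^esub> \<otimes>\<^bsub>wreath_Z3 H\<^esub> x = x" by auto
  next
    fix x assume x: "x \<in> carrier (wreath_Z3 H)"
    then obtain a b c g where abc: "x = ((a, b, c), g)" "a \<in> carrier H" "b \<in> carrier H" "c \<in> carrier H"
      by auto
    from x abc consider "g = 0" | "g = 1" | "g = 2" by auto
    then show "\<exists>y\<in>carrier (wreath_Z3 H). y \<otimes>\<^bsub>wreath_Z3 H\<^esub> x = \<one>\<^bsub>wreath_Z3 H\<^esub>"
    proof cases
      case 1
      show ?thesis
        by (rule bexI[of _ "((inv\<^bsub>H\<^esub> a, inv\<^bsub>H\<^esub> b, inv\<^bsub>H\<^esub> c), 0)"]) (simp_all add: abc 1)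
    next
      case 2
      show ?thesis
        by (rule bexI[of _ "((inv\<^bsub>H\<^esub> b, inv\<^bsub>H\<^esub> c, inv\<^bsub>H\<^esub> a), 2)"]) (simp_all add: abc 2)
    next
      case 3
      show ?thesis
        by (rule bexI[of _ "((inv\<^bsub>H\<^esub> c, inv\<^bsub>H\<^esub> a, inv\<^bsub>H\<^esub> b), 1)"]) (simp_all add: abc 3)
    qed
  qed
qed

text \<open>In suitable coordinates these two elements of the wreath product are the rotation of the
edges around the black vertices and the rotation around the white vertices.\<close>

definition wreath_sigma0 :: "nat \<Rightarrow> ((nat \<Rightarrow> nat) \<times> (nat \<Rightarrow> nat) \<times> (nat \<Rightarrow> nat)) \<times> int" where
  "wreath_sigma0 r = ((right_cycle r, left_cycle r, id), 0)"

definition wreath_sigma1 :: "((nat \<Rightarrow> nat) \<times> (nat \<Rightarrow> nat) \<times> (nat \<Rightarrow> nat)) \<times> int" where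
  "wreath_sigma1 = ((id, id, id), 1)"

lemma carrier_R3:
  "((t1, t2, t3), g) \<in> carrier (R3 r) \<longleftrightarrow>
    t1 permutes {1..2 * r - 1} \<and> t2 permutes {1..2 * r - 1} \<and> t3 permutes {1..2 * r - 1} \<and>
    g \<in> {0, 1, 2} \<and> ((evenperm t1 = evenperm t2) = evenperm t3)"
proof -
  have "evenperm (t1 \<circ> t2 \<circ> t3) = ((evenperm t1 = evenperm t2) = evenperm t3)"
    if "t1 permutes {1..2 * r - 1}" "t2 permutes {1..2 * r - 1}" "t3 permutes {1..2 * r - 1}"
  proof -
    have "permutation t1" "permutation t2" "permutation t3"
      using that permutation_permutes by blast+
    then show ?thesis by (simp add: evenperm_comp permutation_compose)
  qed
  then show ?thesis
    unfolding R3_def Let_def by (auto simp: carrier_wreath_Z3 sym_group_carrier)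
qed

lemma carrier_wreath_Z3_alt:
  "((t1, t2, t3), g) \<in> carrier (wreath_Z3 (alt_group m)) \<longleftrightarrow>
    t1 permutes {1..m} \<and> t2 permutes {1..m} \<and> t3 permutes {1..m} \<and>
    g \<in> {0, 1, 2} \<and> evenperm t1 \<and> evenperm t2 \<and> evenperm t3"
  by (auto simp: carrier_wreath_Z3 alt_group_carrier)

lemma mult_wreath_Z3_sym_base:
  "g \<in> {0, 1, 2} \<Longrightarrow> ((x, y, z), 0) \<otimes>\<^bsub>wreath_Z3 (sym_group m)\<^esub> ((x', y', z'), g) = ((x \<circ> x', y \<circ> y', z \<circ> z'), g)"
  by (auto simp: mult_wreath_Z3 sym_group_mult)

context
  fixes r :: nat
  assumes r: "r \<ge> 1"
begin

private abbreviation "a \<equiv> right_cycle r"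
private abbreviation "b \<equiv> left_cycle r"
private abbreviation "W \<equiv> wreath_Z3 (sym_group (2 * r - 1))"
private abbreviation "H \<equiv> generate W {wreath_sigma0 r, wreath_sigma1}"

interpretation W: group W
  by (intro group_wreath_Z3 sym_group_is_group)

lemma permutes_cycles: "a permutes {1..2 * r - 1}" "b permutes {1..2 * r - 1}"
  using r right_cycle_permutes left_cycle_permutes by auto

private lemma inv0:
  assumes "x permutes {1..2 * r - 1}" "y permutes {1..2 * r - 1}" "z permutes {1..2 * r - 1}"
  shows "inv\<^bsub>W\<^esub> ((x, y, z), 0) = ((inv' x, inv' y, inv' z), 0)"
  using assms
  by (intro W.inv_equality)
    (auto simp: mult_wreath_Z3_sym_base one_wreath_Z3 carrier_wreath_Z3 sym_group_carrier sym_group_one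
      permutes_inv permutes_inv_o)

private lemma inv_sigma1: "inv\<^bsub>W\<^esub> wreath_sigma1 = ((id, id, id), 2)"
  by (intro W.inv_equality)
    (auto simp: wreath_sigma1_def mult_wreath_Z3 one_wreath_Z3 carrier_wreath_Z3 sym_group_carrier
      sym_group_one sym_group_mult permutes_id)

lemma wreath_sigma_in_carrier: "{wreath_sigma0 r, wreath_sigma1} \<subseteq> carrier W"
  using permutes_cycles
  by (auto simp: wreath_sigma0_def wreath_sigma1_def carrier_wreath_Z3 sym_group_carrier permutes_id)

private lemma sigma0_in: "((a, b, id), 0) \<in> H"
  using generate.incl[of "wreath_sigma0 r" _ W] by (simp add: wreath_sigma0_def)

private lemma H_in_carrier:
  "((x, y, z), g) \<in> H \<Longrightarrow> x permutes {1..2 * r - 1} \<and> y permutes {1..2 * r - 1} \<and> z permutes {1..2 * r - 1}"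
  using W.generate_in_carrier[OF wreath_sigma_in_carrier]
  by (auto simp: carrier_wreath_Z3 sym_group_carrier)

private lemma H_comp:
  "((x, y, z), 0) \<in> H \<Longrightarrow> ((x', y', z'), 0) \<in> H \<Longrightarrow> ((x \<circ> x', y \<circ> y', z \<circ> z'), 0) \<in> H"
  using generate.eng[of "((x, y, z), 0)" W _ "((x', y', z'), 0)"] mult_wreath_Z3_sym_base by auto

private lemma H_inv:
  assumes "((x, y, z), 0) \<in> H" shows "((inv' x, inv' y, inv' z), 0) \<in> H"
  using W.generate_m_inv_closed[OF wreath_sigma_in_carrier assms] H_in_carrier[OF assms] inv0 by auto

private lemma H_rotations: "((id, id, id), 0) \<in> H" "((id, id, id), 1) \<in> H" "((id, id, id), 2) \<in> H"
  using generate.one[of W] generate.incl[of wreath_sigma1 _ W] generate.inv[of wreath_sigma1 _ W] inv_sigma1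
  by (auto simp: wreath_sigma1_def one_wreath_Z3 sym_group_one)

private lemma H_rot:
  assumes "((x, y, z), 0) \<in> H" shows "((z, x, y), 0) \<in> H"
proof -
  have "((id, id, id), 1) \<otimes>\<^bsub>W\<^esub> ((x, y, z), 0) \<otimes>\<^bsub>W\<^esub> ((id, id, id), 2) \<in> H"
    by (intro generate.eng H_rotations assms)
  then show ?thesis by (simp add: mult_wreath_Z3 sym_group_mult)
qed

text \<open>The elements \<open>(id, p, id; 0)\<close> of \<open>H\<close> form a group of permutations \<open>p\<close>. Conjugating by
\<open>(id, a, b; 0)\<close> and by \<open>(a, b, id; 0)\<close> shows that it is normalized by \<open>a\<close> and by \<open>b\<close>, and the commutator
of these two elements lies in it, because their first and third components commute.\<close>

private lemma even_in_H:
  assumes p: "p permutes {1..2 * r - 1}" "evenperm p"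
  shows "((id, p, id), 0) \<in> H"
proof -
  have ab: "((id, a, b), 0) \<in> H" using H_rot[OF sigma0_in] .
  note inv_ab = H_inv[OF ab] H_inv[OF sigma0_in]
  have id: "a \<circ> inv' a = id" "b \<circ> inv' b = id" "inv' (id :: nat \<Rightarrow> nat) = id"
    using permutes_cycles permutes_inv_o(1) by (auto simp: inv_id)
  have "p \<in> {k. ((id, k, id), 0) \<in> H}"
    using r _ _ _ _ _ _ p
  proof (rule even_permutations_from_two_cycles)
    show "id \<in> {k. ((id, k, id), 0) \<in> H}" using H_rotations by simp
    fix k assume k: "k \<in> {k. ((id, k, id), 0) \<in> H}"
    show "inv' k \<in> {k. ((id, k, id), 0) \<in> H}"
      using H_inv[of id k id] k id by simp
    show "a \<circ> k \<circ> inv' a \<in> {k. ((id, k, id), 0) \<in> H}"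
      using H_comp[OF H_comp[OF ab, of id k id] inv_ab(1)] k by (simp only: mem_Collect_eq comp_id id_comp id)
    show "b \<circ> k \<circ> inv' b \<in> {k. ((id, k, id), 0) \<in> H}"
      using H_comp[OF H_comp[OF sigma0_in, of id k id] inv_ab(2)] k
      by (simp only: mem_Collect_eq comp_id id_comp id)
    fix q assume q: "q \<in> {k. ((id, k, id), 0) \<in> H}"
    show "k \<circ> q \<in> {k. ((id, k, id), 0) \<in> H}"
      using H_comp[of id k id id q id] k q by (simp only: mem_Collect_eq comp_id id_comp)
  next
    show "a \<circ> b \<circ> inv' a \<circ> inv' b \<in> {k. ((id, k, id), 0) \<in> H}"
      using H_comp[OF H_comp[OF H_comp[OF ab sigma0_in] inv_ab(1)] inv_ab(2)]
      by (simp only: mem_Collect_eq comp_id id_comp id)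
  qed
  then show ?thesis by simp
qed

private lemma evens_in_H:
  assumes "x permutes {1..2 * r - 1}" "y permutes {1..2 * r - 1}" "z permutes {1..2 * r - 1}"
    "evenperm x" "evenperm y" "evenperm z"
  shows "((x, y, z), 0) \<in> H"
proof -
  have "((x, id, id), 0) \<in> H" "((id, y, id), 0) \<in> H" "((id, id, z), 0) \<in> H"
    using assms even_in_H H_rot by blast+
  from H_comp[OF H_comp[OF this(1,2)] this(3)] show ?thesis by simp
qed

private lemma H_base_times_rotation:
  assumes "((x, y, z), 0) \<in> H" "g \<in> {0, 1, 2}" shows "((x, y, z), g) \<in> H"
proof -
  have "((id, id, id), g) \<in> H" using assms(2) H_rotations by auto
  from generate.eng[OF assms(1) this] show ?thesis using assms(2) by (simp add: mult_wreath_Z3_sym_base)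
qed

text \<open>A set closed under multiplication contains \<open>H\<close> if it contains the generators and their
inverses; \<open>rots\<close> covers the second generator, its inverse and the unit.\<close>

private lemma generate_subset:
  assumes gens: "((a, b, id), 0) \<in> C" "((inv' a, inv' b, id), 0) \<in> C"
    and rots: "\<And>g. g \<in> {0, 1, 2} \<Longrightarrow> ((id, id, id), g) \<in> C"
    and mult: "\<And>u v. u \<in> C \<Longrightarrow> v \<in> C \<Longrightarrow> u \<otimes>\<^bsub>W\<^esub> v \<in> C"
  shows "H \<subseteq> C"
proof
  fix u assume "u \<in> H"
  then show "u \<in> C"
  proof (induction rule: generate.induct)
    case one
    then show ?case using rots by (simp add: one_wreath_Z3 sym_group_one)
  next
    case (incl h)
    then show ?case using gens rots by (auto simp: wreath_sigma0_def wreath_sigma1_def)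
  next
    case (inv h)
    then show ?case using gens rots inv_sigma1 inv0[of a b id] permutes_cycles
      by (auto simp: wreath_sigma0_def permutes_id inv_id)
  next
    case (eng u v)
    then show ?case using mult by blast
  qed
qed

private lemma evenperm_comp_permutes:
  "x permutes {1..2 * r - 1} \<Longrightarrow> y permutes {1..2 * r - 1} \<Longrightarrow>
    evenperm (x \<circ> y) = (evenperm x = evenperm y)"
  using evenperm_comp permutation_permutes by (metis finite_atLeastAtMost)

private lemma evenperm_inv_permutes:
  "x permutes {1..2 * r - 1} \<Longrightarrow> evenperm (inv' x) = evenperm x"
  using evenperm_inv permutation_permutes by (metis finite_atLeastAtMost)

lemma generate_wreath_odd:
  assumes "odd r"
  shows "generate W {wreath_sigma0 r, wreath_sigma1} = carrier (wreath_Z3 (alt_group (2 * r - 1)))"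
    (is "_ = ?C")
proof
  show "H \<subseteq> ?C"
  proof (rule generate_subset)
    show "u \<otimes>\<^bsub>W\<^esub> v \<in> ?C" if "u \<in> ?C" "v \<in> ?C" for u v
    proof -
      interpret A: group "wreath_Z3 (alt_group (2 * r - 1))"
        by (intro group_wreath_Z3 alt_group_is_group)
      have "u \<otimes>\<^bsub>W\<^esub> v = u \<otimes>\<^bsub>wreath_Z3 (alt_group (2 * r - 1))\<^esub> v"
        by (simp add: wreath_Z3_def semidirect_def DirProd_def sym_group_mult alt_group_mult
            split: prod.splits)
      then show ?thesis using that A.m_closed by simp
    qed
  qed (use assms r permutes_cycles in
      \<open>auto simp: carrier_wreath_Z3_alt permutes_id evenperm_right_cycle evenperm_left_cycle
        evenperm_inv_permutes permutes_inv\<close>)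
next
  show "?C \<subseteq> H"
  proof
    fix u assume "u \<in> ?C"
    moreover obtain x y z g where "u = ((x, y, z), g)" by (metis prod.exhaust)
    ultimately show "u \<in> H"
      using evens_in_H H_base_times_rotation by (simp add: carrier_wreath_Z3_alt)
  qed
qed

lemma generate_wreath_even:
  assumes "even r"
  shows "generate W {wreath_sigma0 r, wreath_sigma1} = carrier (R3 r)" (is "_ = ?C")
proof
  show "H \<subseteq> ?C"
  proof (rule generate_subset)
    show "u \<otimes>\<^bsub>W\<^esub> v \<in> ?C" if uv: "u \<in> ?C" "v \<in> ?C" for u v
    proof -
      obtain x y z g x' y' z' g' where eq: "u = ((x, y, z), g)" "v = ((x', y', z'), g')"
        by (metis prod.exhaust)
      have perm: "\<forall>p \<in> {x, y, z, x', y', z'}. p permutes {1..2 * r - 1}" and g: "g \<in> {0, 1, 2}"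
        and even: "(evenperm x = evenperm y) = evenperm z" "(evenperm x' = evenperm y') = evenperm z'"
        using uv unfolding eq carrier_R3 by auto
      have "(g + g') mod 3 = 0 \<or> (g + g') mod 3 = 1 \<or> (g + g') mod 3 = 2" by presburger
      then have g': "(g + g') mod 3 \<in> {0, 1, 2}" by simp
      have comp: "p \<circ> q permutes {1..2 * r - 1}" "evenperm (p \<circ> q) = (evenperm p = evenperm q)"
        if "p \<in> {x, y, z}" "q \<in> {x', y', z'}" for p q
        using that perm evenperm_comp_permutes permutes_compose by auto
      from g consider "g = 0" | "g = 1" | "g = 2" by blast
      then show ?thesis
        unfolding eq
        by cases
          ((use g' even in \<open>simp only: mult_wreath_Z3 carrier_R3 sym_group_mult comp
            insert_iff add_0_left simp_thms\<close>; argo)+)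
    qed
  qed (use assms r permutes_cycles in
      \<open>auto simp: carrier_R3 permutes_id evenperm_right_cycle evenperm_left_cycle
        evenperm_inv_permutes permutes_inv\<close>)
next
  have odd: "\<not> evenperm a" "\<not> evenperm b"
    using assms r by (auto simp: evenperm_right_cycle evenperm_left_cycle)
  \<comment> \<open>An element of \<open>H\<close> with the right parities differs from \<open>(x, y, z; 0)\<close> by a triple of even
    permutations.\<close>
  have correct: "((x, y, z), 0) \<in> H"
    if h: "((f1, f2, f3), 0) \<in> H"
      and perm: "x permutes {1..2 * r - 1}" "y permutes {1..2 * r - 1}" "z permutes {1..2 * r - 1}"
      and par: "evenperm f1 = evenperm x" "evenperm f2 = evenperm y" "evenperm f3 = evenperm z"
    for f1 f2 f3 x y z
  proof -
    have f: "f1 permutes {1..2 * r - 1}" "f2 permutes {1..2 * r - 1}" "f3 permutes {1..2 * r - 1}"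
      using H_in_carrier[OF h] by auto
    have "((inv' f1 \<circ> x, inv' f2 \<circ> y, inv' f3 \<circ> z), 0) \<in> H"
      using f perm par
      by (intro evens_in_H) (auto simp: evenperm_comp_permutes evenperm_inv_permutes permutes_inv permutes_compose)
    from H_comp[OF h this] show ?thesis
      using f by (simp add: o_assoc permutes_inv_o)
  qed
  show "?C \<subseteq> H"
  proof
    fix u assume u: "u \<in> ?C"
    obtain x y z g where eq: "u = ((x, y, z), g)" by (metis prod.exhaust)
    have perm: "x permutes {1..2 * r - 1}" "y permutes {1..2 * r - 1}" "z permutes {1..2 * r - 1}"
      and g: "g \<in> {0, 1, 2}"
      and "(evenperm x = evenperm y) = evenperm z"
      using u unfolding eq carrier_R3 by auto
    then consider "evenperm x" "evenperm y" "evenperm z" | "\<not> evenperm x" "\<not> evenperm y" "evenperm z"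
      | "evenperm x" "\<not> evenperm y" "\<not> evenperm z" | "\<not> evenperm x" "evenperm y" "\<not> evenperm z"
      by blast
    then have "((x, y, z), 0) \<in> H"
    proof cases
      case 1
      then show ?thesis using evens_in_H perm by blast
    next
      case 2
      then show ?thesis using odd by (intro correct[OF sigma0_in] perm) auto
    next
      case 3
      then show ?thesis using odd by (intro correct[OF H_rot[OF sigma0_in]] perm) auto
    next
      case 4
      then show ?thesis using odd by (intro correct[OF H_rot[OF H_rot[OF sigma0_in]]] perm) auto
    qed
    then show "u \<in> H" unfolding eq using g by (rule H_base_times_rotation)
  qed
qed

end

section \<open>The imprimitive action of the wreath product\<close>

text \<open>The component with number 0, 1 or 2 of a triple.\<close>

fun pick :: "'a \<times> 'a \<times> 'a \<Rightarrow> nat \<Rightarrow> 'a" where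
  "pick (a, b, c) d = (if d = 0 then a else if d = 1 then b else c)"

text \<open>Three blocks, numbered 0, 1 and 2, each a copy of \<open>{1..m}\<close>: a point is a pair of a block
and an element of the block.\<close>

definition wreath_points :: "nat \<Rightarrow> (nat \<times> nat) set" where
  "wreath_points m = {..<3} \<times> {1..m}"

text \<open>The cyclic part moves a point from block \<open>c\<close> to block \<open>d = c + g\<close> modulo 3, and then the \<open>d\<close>-th
permutation acts inside that block. Taking the permutation of the target block is what matches the
direction of \<open>shift3\<close> in the semidirect product.\<close>

definition wreath_act ::
    "((nat \<Rightarrow> nat) \<times> (nat \<Rightarrow> nat) \<times> (nat \<Rightarrow> nat)) \<times> int \<Rightarrow> nat \<times> nat \<Rightarrow> nat \<times> nat" where
  "wreath_act x p = (let d = (fst p + nat (snd x)) mod 3 in (d, pick (fst x) d (snd p)))"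

lemma wreath_points_cases:
  assumes "p \<in> wreath_points m"
  obtains i where "i \<in> {1..m}" "p = (0, i)" | i where "i \<in> {1..m}" "p = (1, i)"
    | i where "i \<in> {1..m}" "p = (2, i)"
proof -
  obtain c i where "p = (c, i)" "c < 3" "i \<in> {1..m}"
    using assms by (auto simp: wreath_points_def)
  moreover have "c = 0 \<or> c = 1 \<or> c = 2" using \<open>c < 3\<close> by linarith
  ultimately show ?thesis using that by blast
qed

lemma wreath_act_simps:
  "wreath_act ((a, b, c), 0) (0, i) = (0, a i)"
  "wreath_act ((a, b, c), 0) (1, i) = (1, b i)"
  "wreath_act ((a, b, c), 0) (2, i) = (2, c i)"
  "wreath_act ((a, b, c), 1) (0, i) = (1, b i)"
  "wreath_act ((a, b, c), 1) (1, i) = (2, c i)"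
  "wreath_act ((a, b, c), 1) (2, i) = (0, a i)"
  "wreath_act ((a, b, c), 2) (0, i) = (2, c i)"
  "wreath_act ((a, b, c), 2) (1, i) = (0, a i)"
  "wreath_act ((a, b, c), 2) (2, i) = (1, b i)"
  by (simp_all add: wreath_act_def)

lemma carrier_wreath_Z3_sym_cases:
  assumes "x \<in> carrier (wreath_Z3 (sym_group m))"
  obtains a b c g where "x = ((a, b, c), g)" "a permutes {1..m}" "b permutes {1..m}" "c permutes {1..m}"
    "g = 0 \<or> g = 1 \<or> g = 2"
  using assms by (auto simp: carrier_wreath_Z3 sym_group_carrier)

lemma wreath_act_closed:
  assumes "x \<in> carrier (wreath_Z3 (sym_group m))" "p \<in> wreath_points m"
  shows "wreath_act x p \<in> wreath_points m"
proof -
  have "pick t d i \<in> {1..m}"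
    if "fst t permutes {1..m}" "fst (snd t) permutes {1..m}" "snd (snd t) permutes {1..m}" "i \<in> {1..m}"
    for t :: "(nat \<Rightarrow> nat) \<times> (nat \<Rightarrow> nat) \<times> (nat \<Rightarrow> nat)" and d i
  proof -
    obtain f g h where t: "t = (f, g, h)" by (metis prod.exhaust)
    from that show ?thesis unfolding t using permutes_in_image by fastforce
  qed
  then show ?thesis
    using assms by (auto simp: wreath_act_def wreath_points_def Let_def elim!: carrier_wreath_Z3_sym_cases)
qed

lemma wreath_act_mult:
  assumes "x \<in> carrier (wreath_Z3 (sym_group m))" "y \<in> carrier (wreath_Z3 (sym_group m))"
    "p \<in> wreath_points m"
  shows "wreath_act (x \<otimes>\<^bsub>wreath_Z3 (sym_group m)\<^esub> y) p = wreath_act x (wreath_act y p)"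
proof -
  obtain a b c g where x: "x = ((a, b, c), g)" "g = 0 \<or> g = 1 \<or> g = 2"
    using assms(1) by (rule carrier_wreath_Z3_sym_cases)
  obtain a' b' c' g' where y: "y = ((a', b', c'), g')" "g' = 0 \<or> g' = 1 \<or> g' = 2"
    using assms(2) by (rule carrier_wreath_Z3_sym_cases)
  from assms(3) show ?thesis
    by (cases rule: wreath_points_cases; use x(2) y(2) in \<open>elim disjE\<close>)
      (simp_all add: x(1) y(1) mult_wreath_Z3 sym_group_mult wreath_act_simps
        del: One_nat_def)
qed

lemma wreath_act_faithful:
  assumes "x \<in> carrier (wreath_Z3 (sym_group m))" "y \<in> carrier (wreath_Z3 (sym_group m))" "m \<ge> 1"
    and eq: "\<And>p. p \<in> wreath_points m \<Longrightarrow> wreath_act x p = wreath_act y p"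
  shows "x = y"
proof -
  obtain a b c g where x: "x = ((a, b, c), g)" "a permutes {1..m}" "b permutes {1..m}" "c permutes {1..m}"
      "g = 0 \<or> g = 1 \<or> g = 2"
    using assms(1) by (rule carrier_wreath_Z3_sym_cases)
  obtain a' b' c' g' where y: "y = ((a', b', c'), g')" "a' permutes {1..m}" "b' permutes {1..m}"
      "c' permutes {1..m}" "g' = 0 \<or> g' = 1 \<or> g' = 2"
    using assms(2) by (rule carrier_wreath_Z3_sym_cases)
  have pts: "(0, i) \<in> wreath_points m" "(1, i) \<in> wreath_points m" "(2, i) \<in> wreath_points m"
    if "i \<in> {1..m}" for i
    using that by (auto simp: wreath_points_def)
  have g: "g = g'"
    using eq[OF pts(1)[of 1]] \<open>m \<ge> 1\<close> x(5) y(5)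
    by (auto simp: x(1) y(1) wreath_act_simps)
  have "a i = a' i \<and> b i = b' i \<and> c i = c' i" if "i \<in> {1..m}" for i
    using x(5) eq[OF pts(1)[OF that]] eq[OF pts(2)[OF that]] eq[OF pts(3)[OF that]]
    unfolding x(1) y(1) g[symmetric]
    by (elim disjE) (simp_all add: wreath_act_simps del: One_nat_def)
  moreover have "a i = a' i \<and> b i = b' i \<and> c i = c' i" if "i \<notin> {1..m}" for i
    using that x(2-4) y(2-4) by (simp add: permutes_not_in)
  ultimately show ?thesis using g unfolding x(1) y(1) by (auto simp: fun_eq_iff)
qed

lemma wreath_act_one: "p \<in> wreath_points m \<Longrightarrow> wreath_act \<one>\<^bsub>wreath_Z3 (sym_group m)\<^esub> p = p"
  by (erule wreath_points_cases)
    (simp_all add: one_wreath_Z3 sym_group_one wreath_act_simps del: One_nat_def)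

text \<open>The permutation of \<open>{1..n}\<close> by which an element of the wreath product acts when \<open>\<beta>\<close>
numbers the points, continued by the identity.\<close>

definition wreath_perm ::
    "nat \<Rightarrow> nat \<Rightarrow> (nat \<times> nat \<Rightarrow> nat) \<Rightarrow>
     ((nat \<Rightarrow> nat) \<times> (nat \<Rightarrow> nat) \<times> (nat \<Rightarrow> nat)) \<times> int \<Rightarrow> nat \<Rightarrow> nat" where
  "wreath_perm m n \<beta> x i =
     (if i \<in> {1..n} then \<beta> (wreath_act x (inv_into (wreath_points m) \<beta> i)) else i)"

lemma wreath_perm_apply:
  assumes "bij_betw \<beta> (wreath_points m) {1..n}" "p \<in> wreath_points m"
  shows "wreath_perm m n \<beta> x (\<beta> p) = \<beta> (wreath_act x p)"
  using assms bij_betw_apply[OF assms] bij_betw_inv_into_left[OF assms]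
  by (simp add: wreath_perm_def)

lemma wreath_perm_eqI:
  assumes \<beta>: "bij_betw \<beta> (wreath_points m) {1..n}"
    and "\<And>p. p \<in> wreath_points m \<Longrightarrow> s (\<beta> p) = \<beta> (wreath_act x p)"
    and "\<And>i. i \<notin> {1..n} \<Longrightarrow> s i = i"
  shows "s = wreath_perm m n \<beta> x"
proof
  fix i
  show "s i = wreath_perm m n \<beta> x i"
  proof (cases "i \<in> {1..n}")
    case True
    then obtain p where "p \<in> wreath_points m" "i = \<beta> p"
      using \<beta> by (metis bij_betw_def imageE)
    then show ?thesis using assms wreath_perm_apply by metis
  qed (use assms in \<open>auto simp: wreath_perm_def\<close>)
qed

lemma wreath_perm_mult:
  assumes \<beta>: "bij_betw \<beta> (wreath_points m) {1..n}"
    and xy: "x \<in> carrier (wreath_Z3 (sym_group m))" "y \<in> carrier (wreath_Z3 (sym_group m))"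
  shows "wreath_perm m n \<beta> (x \<otimes>\<^bsub>wreath_Z3 (sym_group m)\<^esub> y) =
    wreath_perm m n \<beta> x \<circ> wreath_perm m n \<beta> y"
proof (rule wreath_perm_eqI[OF \<beta>, symmetric])
  show "(wreath_perm m n \<beta> x \<circ> wreath_perm m n \<beta> y) (\<beta> p) =
      \<beta> (wreath_act (x \<otimes>\<^bsub>wreath_Z3 (sym_group m)\<^esub> y) p)" if "p \<in> wreath_points m" for p
    using that wreath_act_closed[OF xy(2) that]
    by (simp add: wreath_perm_apply[OF \<beta>] wreath_act_mult[OF xy])
qed (auto simp: wreath_perm_def)

lemma group_hom_wreath_perm:
  assumes \<beta>: "bij_betw \<beta> (wreath_points m) {1..n}"
  shows "group_hom (wreath_Z3 (sym_group m)) (sym_group n) (wreath_perm m n \<beta>)"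
proof -
  interpret W: group "wreath_Z3 (sym_group m)"
    by (intro group_wreath_Z3 sym_group_is_group)
  have one: "wreath_perm m n \<beta> \<one>\<^bsub>wreath_Z3 (sym_group m)\<^esub> = id"
    by (rule wreath_perm_eqI[OF \<beta>, symmetric]) (auto simp: wreath_act_one)
  have "wreath_perm m n \<beta> x permutes {1..n}" if x: "x \<in> carrier (wreath_Z3 (sym_group m))" for x
  proof -
    have "wreath_perm m n \<beta> x \<circ> wreath_perm m n \<beta> (inv\<^bsub>wreath_Z3 (sym_group m)\<^esub> x) = id"
      "wreath_perm m n \<beta> (inv\<^bsub>wreath_Z3 (sym_group m)\<^esub> x) \<circ> wreath_perm m n \<beta> x = id"
      using x one by (simp_all flip: wreath_perm_mult[OF \<beta>])
    then have "bij (wreath_perm m n \<beta> x)" using o_bij by blast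
    then show ?thesis by (auto simp: permutes_def bij_iff wreath_perm_def)
  qed
  then show ?thesis
    by (intro group_hom.intro W.is_group sym_group_is_group group_hom_axioms.intro homI)
      (simp_all add: sym_group_carrier sym_group_mult wreath_perm_mult[OF \<beta>])
qed

lemma inj_on_wreath_perm:
  assumes \<beta>: "bij_betw \<beta> (wreath_points m) {1..n}" and "m \<ge> 1"
  shows "inj_on (wreath_perm m n \<beta>) (carrier (wreath_Z3 (sym_group m)))"
proof (rule inj_onI)
  fix x y assume xy: "x \<in> carrier (wreath_Z3 (sym_group m))" "y \<in> carrier (wreath_Z3 (sym_group m))"
    and eq: "wreath_perm m n \<beta> x = wreath_perm m n \<beta> y"
  show "x = y"
  proof (rule wreath_act_faithful[OF xy \<open>m \<ge> 1\<close>])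
    fix p assume p: "p \<in> wreath_points m"
    then have "\<beta> (wreath_act x p) = \<beta> (wreath_act y p)"
      using eq wreath_perm_apply[OF \<beta>] by metis
    then show "wreath_act x p = wreath_act y p"
      using wreath_act_closed[OF _ p] xy \<beta> by (metis bij_betw_def inj_onD)
  qed
qed

lemma generate_image_iso:
  assumes "group_hom G K \<phi>" "inj_on \<phi> (carrier G)" "X \<subseteq> carrier G"
  shows "K\<lparr>carrier := generate K (\<phi> ` X)\<rparr> \<cong> G\<lparr>carrier := generate G X\<rparr>"
proof -
  interpret group_hom G K \<phi> by fact
  have "group (G\<lparr>carrier := generate G X\<rparr>)"
    using G.generate_is_subgroup[OF assms(3)] by (rule G.subgroup_imp_group)
  moreover have "\<phi> \<in> iso (G\<lparr>carrier := generate G X\<rparr>) (K\<lparr>carrier := generate K (\<phi> ` X)\<rparr>)"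
    using assms(2) G.generate_incl[OF assms(3)]
    by (intro isoI homI) (auto simp: generate_img[OF assms(3)] bij_betw_def inj_on_subset subset_iff)
  ultimately show ?thesis using group.iso_sym is_isoI by blast
qed

text \<open>Two permutations that act on \<open>{1..n}\<close>, numbered by \<open>\<beta>\<close>, as the two distinguished
elements of the wreath product generate an isomorphic copy of the subgroup generated by these.\<close>

theorem generate_wreath_perm_iso:
  assumes r: "r \<ge> 1" and \<beta>: "bij_betw \<beta> (wreath_points (2 * r - 1)) {1..n}"
    and s0: "\<And>p. p \<in> wreath_points (2 * r - 1) \<Longrightarrow> s0 (\<beta> p) = \<beta> (wreath_act (wreath_sigma0 r) p)"
    and s1: "\<And>p. p \<in> wreath_points (2 * r - 1) \<Longrightarrow> s1 (\<beta> p) = \<beta> (wreath_act wreath_sigma1 p)"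
    and out: "\<And>i. i \<notin> {1..n} \<Longrightarrow> s0 i = i" "\<And>i. i \<notin> {1..n} \<Longrightarrow> s1 i = i"
  shows "(sym_group n)\<lparr>carrier := generate (sym_group n) {s0, s1}\<rparr> \<cong>
    (if odd r then wreath_Z3 (alt_group (2 * r - 1)) else R3 r)"
proof -
  let ?W = "wreath_Z3 (sym_group (2 * r - 1))"
  have "s0 = wreath_perm (2 * r - 1) n \<beta> (wreath_sigma0 r)"
    "s1 = wreath_perm (2 * r - 1) n \<beta> wreath_sigma1"
    using wreath_perm_eqI[OF \<beta>] s0 s1 out by blast+
  then have "(sym_group n)\<lparr>carrier := generate (sym_group n) {s0, s1}\<rparr> \<cong>
      ?W\<lparr>carrier := generate ?W {wreath_sigma0 r, wreath_sigma1}\<rparr>"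
    using generate_image_iso[OF group_hom_wreath_perm[OF \<beta>] inj_on_wreath_perm[OF \<beta>]
        wreath_sigma_in_carrier[OF r]] r
    by simp
  moreover have "?W\<lparr>carrier := carrier (wreath_Z3 (alt_group (2 * r - 1)))\<rparr> =
      wreath_Z3 (alt_group (2 * r - 1))"
    by (simp add: wreath_Z3_def semidirect_def DirProd_def sym_group_mult alt_group_mult
        sym_group_one alt_group_one)
  moreover have "?W\<lparr>carrier := carrier (R3 r)\<rparr> = R3 r"
    by (simp add: R3_def Let_def)
  ultimately show ?thesis
    using generate_wreath_odd[OF r] generate_wreath_even[OF r] by auto
qed

section \<open>Rotation of the edges of a dessin\<close>

lemma orbit_eq_funpow_image:
  assumes "x \<in> orbit f x" "card (orbit f x) = n"
  shows "orbit f x = (\<lambda>k. (f ^^ k) x) ` {..<n}" "inj_on (\<lambda>k. (f ^^ k) x) {..<n}" "(f ^^ n) x = x"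
proof -
  let ?d = "funpow_dist1 f x x"
  have orb: "orbit f x = (\<lambda>k. (f ^^ k) x) ` {..<?d}"
    using orbit_conv_funpow_dist1[OF assms(1)] by (simp add: atLeast0LessThan)
  have inj: "inj_on (\<lambda>k. (f ^^ k) x) {..<?d}"
    using inj_on_funpow_dist1[OF assms(1)] by (simp add: atLeast0LessThan)
  have "?d = n" using assms(2) unfolding orb by (simp add: card_image[OF inj])
  then show "orbit f x = (\<lambda>k. (f ^^ k) x) ` {..<n}" "inj_on (\<lambda>k. (f ^^ k) x) {..<n}" "(f ^^ n) x = x"
    using orb inj funpow_dist1_prop[OF assms(1)] by simp_all
qed

text \<open>The successor of an edge around its black end, and around its white end. On the edges these
are the permutations \<open>\<sigma>\<^sub>0\<close> and \<open>\<sigma>\<^sub>1\<close> before the edges are numbered.\<close>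

definition bsucc :: "('v, 'e) dessin \<Rightarrow> 'e \<Rightarrow> 'e" where
  "bsucc D e = rot D (bend D e) e"

definition wsucc :: "('v, 'e) dessin \<Rightarrow> 'e \<Rightarrow> 'e" where
  "wsucc D e = rot D (wend D e) e"

lemma is_dessinD:
  assumes "is_dessin D"
  shows "finite (black D)" "finite (white D)" "finite (edges D)" "black D \<inter> white D = {}"
    "e \<in> edges D \<Longrightarrow> bend D e \<in> black D" "e \<in> edges D \<Longrightarrow> wend D e \<in> white D"
  using assms unfolding is_dessin_def vertices_def by auto

lemma edges_at_bend:
  assumes "is_dessin D" "v \<in> black D"
  shows "edges_at D v = {e \<in> edges D. bend D e = v}"
  using assms(2) is_dessinD(4-6)[OF assms(1)] unfolding edges_at_def by auto

lemma edges_at_wend: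
  assumes "is_dessin D" "v \<in> white D"
  shows "edges_at D v = {e \<in> edges D. wend D e = v}"
  using assms(2) is_dessinD(4-6)[OF assms(1)] unfolding edges_at_def by auto

lemma orbit_rot:
  assumes D: "is_dessin D" and v: "v \<in> vertices D" and e: "e \<in> edges_at D v"
    and s: "\<And>x. x \<in> edges_at D v \<Longrightarrow> s x = rot D v x"
  shows "orbit s e = edges_at D v"
proof -
  have cyc: "cyclic_on (rot D v) (edges_at D v)"
    using D v e unfolding is_dessin_def by blast
  then have "orbit (rot D v) e = edges_at D v" using e by (rule orbit_cyclic_eq3)
  moreover have "orbit s e = orbit (rot D v) e"
    using e s cyclic_on_inI[OF cyc] by (intro orbit_cong0) auto
  ultimately show ?thesis by simp
qed

lemma orbit_bsucc:
  assumes "is_dessin D" "e \<in> edges D"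
  shows "orbit (bsucc D) e = {e' \<in> edges D. bend D e' = bend D e}"
proof -
  have b: "bend D e \<in> black D" using is_dessinD assms by metis
  then show ?thesis
    using orbit_rot[OF assms(1), of "bend D e" e "bsucc D"] assms
    by (auto simp: edges_at_bend[OF assms(1) b] bsucc_def vertices_def)
qed

lemma orbit_wsucc:
  assumes "is_dessin D" "e \<in> edges D"
  shows "orbit (wsucc D) e = {e' \<in> edges D. wend D e' = wend D e}"
proof -
  have b: "wend D e \<in> white D" using is_dessinD assms by metis
  then show ?thesis
    using orbit_rot[OF assms(1), of "wend D e" e "wsucc D"] assms
    by (auto simp: edges_at_wend[OF assms(1) b] wsucc_def vertices_def)
qed

lemma same_end_iff:
  assumes g: "bij_betw g E E'" and e: "e \<in> E" "e2 \<in> E"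
    and orb: "orbit s e = {x \<in> E. vtx x = vtx e}"
    and orb': "orbit s' (g e) = {x \<in> E'. vtx' x = vtx' (g e)}"
    and comm: "\<And>x. x \<in> E \<Longrightarrow> g (s x) = s' (g x)"
  shows "vtx e = vtx e2 \<longleftrightarrow> vtx' (g e) = vtx' (g e2)"
proof -
  have img: "g ` orbit s e = orbit s' (g e)"
    by (rule orbit_inverse) (use e orb comm in auto)
  have "orbit s e \<subseteq> E" using orb by auto
  then have "e2 \<in> orbit s e \<longleftrightarrow> g e2 \<in> orbit s' (g e)"
    using g e unfolding img[symmetric] by (auto simp: bij_betw_def dest: inj_onD)
  moreover have "e2 \<in> orbit s e \<longleftrightarrow> vtx e2 = vtx e" by (simp add: orb e)
  moreover have "g e2 \<in> E'" using g e by (auto simp: bij_betw_def)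
  then have "g e2 \<in> orbit s' (g e) \<longleftrightarrow> vtx' (g e2) = vtx' (g e)" by (simp add: orb')
  ultimately show ?thesis by metis
qed

lemma induced_bijection:
  assumes g: "bij_betw g E E'"
    and iff: "\<And>e e2. e \<in> E \<Longrightarrow> e2 \<in> E \<Longrightarrow> vtx e = vtx e2 \<longleftrightarrow> vtx' (g e) = vtx' (g e2)"
  obtains f where "bij_betw f (vtx ` E) (vtx' ` E')" "\<And>e. e \<in> E \<Longrightarrow> f (vtx e) = vtx' (g e)"
proof -
  define f where "f v = vtx' (g (inv_into E vtx v))" for v
  have f: "f (vtx e) = vtx' (g e)" if "e \<in> E" for e
    unfolding f_def using iff[of "inv_into E vtx (vtx e)" e] that
    by (simp add: f_inv_into_f inv_into_into)
  have "inj_on f (vtx ` E)" using f iff by (auto intro!: inj_onI)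
  moreover have "f ` vtx ` E = vtx' ` E'"
    using f g by (auto simp: bij_betw_def image_iff)
  ultimately show ?thesis using that f by (auto simp: bij_betw_def)
qed

text \<open>In a dessin without isolated vertices the black (white) vertices are the cycles of \<open>bsucc\<close>
(of \<open>wsucc\<close>), so a bijection of the edges that commutes with both successors extends to the
vertices.\<close>

lemma isomorphicI:
  assumes D: "is_dessin D" "\<And>v. v \<in> vertices D \<Longrightarrow> edges_at D v \<noteq> {}"
    and D': "is_dessin D'" "\<And>v. v \<in> vertices D' \<Longrightarrow> edges_at D' v \<noteq> {}"
    and g: "bij_betw g (edges D) (edges D')"
    and comm0: "\<And>e. e \<in> edges D \<Longrightarrow> g (bsucc D e) = bsucc D' (g e)"
    and comm1: "\<And>e. e \<in> edges D \<Longrightarrow> g (wsucc D e) = wsucc D' (g e)"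
  shows "isomorphic D D'"
proof -
  have ends: "bend X ` edges X = black X \<and> wend X ` edges X = white X"
    if "is_dessin X" "\<And>v. v \<in> vertices X \<Longrightarrow> edges_at X v \<noteq> {}" for X :: "('x, 'y) dessin"
  proof (intro conjI equalityI)
    show "bend X ` edges X \<subseteq> black X" "wend X ` edges X \<subseteq> white X"
      using is_dessinD[OF that(1)] by auto
    show "black X \<subseteq> bend X ` edges X"
    proof
      fix v assume v: "v \<in> black X"
      then have "edges_at X v \<noteq> {}" using that(2) by (simp add: vertices_def)
      then show "v \<in> bend X ` edges X" using edges_at_bend[OF that(1) v] by auto
    qed
    show "white X \<subseteq> wend X ` edges X"
    proof
      fix v assume v: "v \<in> white X"
      then have "edges_at X v \<noteq> {}" using that(2) by (simp add: vertices_def)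
      then show "v \<in> wend X ` edges X" using edges_at_wend[OF that(1) v] by auto
    qed
  qed
  have gE: "g e \<in> edges D'" if "e \<in> edges D" for e using g that by (auto simp: bij_betw_def)
  have "bend D e = bend D e2 \<longleftrightarrow> bend D' (g e) = bend D' (g e2)"
    if "e \<in> edges D" "e2 \<in> edges D" for e e2
    using same_end_iff[OF g that orbit_bsucc[OF D(1) that(1)] orbit_bsucc[OF D'(1) gE[OF that(1)]] comm0] .
  from induced_bijection[where vtx = "bend D" and vtx' = "bend D'", OF g this] obtain f0
    where f0: "bij_betw f0 (bend D ` edges D) (bend D' ` edges D')"
      "\<And>e. e \<in> edges D \<Longrightarrow> f0 (bend D e) = bend D' (g e)" by metis
  have "wend D e = wend D e2 \<longleftrightarrow> wend D' (g e) = wend D' (g e2)"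
    if "e \<in> edges D" "e2 \<in> edges D" for e e2
    using same_end_iff[OF g that orbit_wsucc[OF D(1) that(1)] orbit_wsucc[OF D'(1) gE[OF that(1)]] comm1] .
  from induced_bijection[where vtx = "wend D" and vtx' = "wend D'", OF g this] obtain f1
    where f1: "bij_betw f1 (wend D ` edges D) (wend D' ` edges D')"
      "\<And>e. e \<in> edges D \<Longrightarrow> f1 (wend D e) = wend D' (g e)" by metis
  define f where "f v = (if v \<in> black D then f0 v else f1 v)" for v
  have fb: "f (bend D e) = bend D' (g e)" and fw: "f (wend D e) = wend D' (g e)" if "e \<in> edges D" for e
    using is_dessinD(4-6)[OF D(1)] that f0(2)[OF that] f1(2)[OF that] unfolding f_def by auto
  have "bij_betw f (black D) (black D')"
    using f0(1) ends[OF D] ends[OF D'] by (subst bij_betw_cong[of _ _ f0]) (auto simp: f_def)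
  moreover have "bij_betw f (white D) (white D')"
    using f1(1) ends[OF D] ends[OF D'] is_dessinD(4)[OF D(1)]
    by (subst bij_betw_cong[of _ _ f1]) (auto simp: f_def)
  moreover have "g (rot D v e) = rot D' (f v) (g e)" if "v \<in> vertices D" "e \<in> edges_at D v" for v e
  proof -
    have e: "e \<in> edges D" and "bend D e = v \<or> wend D e = v" using that(2) by (auto simp: edges_at_def)
    then show ?thesis
      using comm0[OF e] comm1[OF e] fb[OF e] fw[OF e] by (auto simp: bsucc_def wsucc_def)
  qed
  ultimately show ?thesis
    unfolding isomorphic_def using g fb fw
    by (intro exI[of _ f] exI[of _ g] conjI ballI) simp_all
qed

section \<open>The shape of a tree with the given passport\<close>

text \<open>A tree with the passport \<open>[r\<^sup>2, 1\<^bsup>4r-3\<^esup>; 3\<^bsup>2r-1\<^esup>]\<close>.\<close>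

locale passport_tree =
  fixes D :: "('v, 'e) dessin" and r :: nat
  assumes tree: "is_tree_dessin D"
    and r: "r \<ge> 1"
    and passport: "passport D =
      (replicate_mset 2 r + replicate_mset (4 * r - 3) 1, replicate_mset (2 * r - 1) 3)"
begin

lemma dessin: "is_dessin D" and acyclic: "\<not> graph_cycle D vs es"
  using tree unfolding is_tree_dessin_def by auto

lemmas dessinD = is_dessinD[OF dessin]

lemma black_degrees: "image_mset (deg D) (mset_set (black D)) = replicate_mset 2 r + replicate_mset (4 * r - 3) 1"
  and white_degrees: "image_mset (deg D) (mset_set (white D)) = replicate_mset (2 * r - 1) 3"
  using passport unfolding passport_def by auto

lemma card_white: "card (white D) = 2 * r - 1"
  using arg_cong[OF white_degrees, of size] by simp

lemma deg_white:
  assumes "w \<in> white D" shows "deg D w = 3"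
proof -
  have "deg D w \<in># image_mset (deg D) (mset_set (white D))"
    using assms dessinD(2) by simp
  then show ?thesis unfolding white_degrees by (simp split: if_splits)
qed

lemma deg_black:
  assumes "b \<in> black D" shows "deg D b = 1 \<or> deg D b = r"
proof -
  have "deg D b \<in># image_mset (deg D) (mset_set (black D))"
    using assms dessinD(1) by simp
  then show ?thesis unfolding black_degrees by (auto split: if_splits)
qed

lemma card_black_r:
  assumes "r \<ge> 2" shows "card {b \<in> black D. deg D b = r} = 2"
proof -
  have "filter_mset (\<lambda>x. x = r) (image_mset (deg D) (mset_set (black D))) =
      image_mset (deg D) (filter_mset (\<lambda>b. deg D b = r) (mset_set (black D)))"
    by (simp add: filter_mset_image_mset)
  also have "size \<dots> = card {b \<in> black D. deg D b = r}"
    using dessinD(1) by (simp add: filter_mset_mset_set)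
  finally show ?thesis
    using assms unfolding black_degrees filter_eq_replicate_mset by simp
qed

lemma no_isolated_vertex:
  assumes "v \<in> vertices D" shows "edges_at D v \<noteq> {}"
proof -
  have "deg D v \<noteq> 0"
    using assms deg_black[of v] deg_white[of v] r by (auto simp: vertices_def)
  then show ?thesis unfolding deg_def by auto
qed

abbreviation "s0 \<equiv> bsucc D"
abbreviation "s1 \<equiv> wsucc D"

lemma bend_neq_wend:
  "e \<in> edges D \<Longrightarrow> e' \<in> edges D \<Longrightarrow> bend D e \<noteq> wend D e'"
  using dessinD(4) dessinD(5)[of e] dessinD(6)[of e'] by auto

lemma no_parallel_edges:
  assumes "e \<in> edges D" "e' \<in> edges D" "bend D e = bend D e'" "wend D e = wend D e'"
  shows "e = e'"
proof (rule ccontr)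
  assume "e \<noteq> e'"
  moreover have "bend D e \<noteq> wend D e" using assms bend_neq_wend by simp
  ultimately have "graph_cycle D [bend D e, wend D e] [e, e']"
    using assms by (auto simp: graph_cycle_def joins_def less_Suc_eq)
  then show False using acyclic by blast
qed

lemma no_square:
  assumes "{e1, e2, e3, e4} \<subseteq> edges D"
    and "bend D e1 = bend D e4" "bend D e2 = bend D e3" "bend D e1 \<noteq> bend D e2"
    and "wend D e1 = wend D e2" "wend D e3 = wend D e4"
  shows "wend D e1 = wend D e3"
proof (rule ccontr)
  assume neq: "wend D e1 \<noteq> wend D e3"
  have "distinct [e1, e2, e3, e4]" using assms neq by auto
  moreover have "distinct [bend D e1, wend D e1, bend D e2, wend D e3]"
    using assms neq bend_neq_wend not_sym[OF bend_neq_wend] by simp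
  moreover have "joins D ([e1, e2, e3, e4] ! i) ([bend D e1, wend D e1, bend D e2, wend D e3] ! i)
      ([bend D e1, wend D e1, bend D e2, wend D e3] ! (Suc i mod 4))" if "i < 4" for i
  proof -
    have "i = 0 \<or> i = 1 \<or> i = 2 \<or> i = 3" using that by linarith
    then show ?thesis
      using assms by (elim disjE) (simp_all add: joins_def doubleton_eq_iff)
  qed
  ultimately have "graph_cycle D [bend D e1, wend D e1, bend D e2, wend D e3] [e1, e2, e3, e4]"
    by (simp add: graph_cycle_def)
  then show False using acyclic by blast
qed

lemma orbit_s0:
  assumes "e \<in> edges D" "deg D (bend D e) = n"
  shows "{e' \<in> edges D. bend D e' = bend D e} = (\<lambda>k. (s0 ^^ k) e) ` {..<n}"
    "inj_on (\<lambda>k. (s0 ^^ k) e) {..<n}" "(s0 ^^ n) e = e"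
proof -
  note orb = orbit_bsucc[OF dessin assms(1)]
  have "e \<in> orbit s0 e" using assms orb by simp
  moreover have "card (orbit s0 e) = n"
    using assms dessinD(5) unfolding orb deg_def by (simp add: edges_at_bend[OF dessin])
  ultimately show "{e' \<in> edges D. bend D e' = bend D e} = (\<lambda>k. (s0 ^^ k) e) ` {..<n}"
    "inj_on (\<lambda>k. (s0 ^^ k) e) {..<n}" "(s0 ^^ n) e = e"
    using orbit_eq_funpow_image unfolding orb[symmetric] by metis+
qed

lemma orbit_s1:
  assumes "e \<in> edges D"
  shows "{e' \<in> edges D. wend D e' = wend D e} = (\<lambda>k. (s1 ^^ k) e) ` {..<3}"
    "inj_on (\<lambda>k. (s1 ^^ k) e) {..<3}" "(s1 ^^ 3) e = e"
proof -
  note orb = orbit_wsucc[OF dessin assms(1)]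
  have "e \<in> orbit s1 e" using assms orb by simp
  moreover have "card (orbit s1 e) = 3"
    using deg_white[of "wend D e"] assms dessinD(6) unfolding orb deg_def
    by (simp add: edges_at_wend[OF dessin])
  ultimately show "{e' \<in> edges D. wend D e' = wend D e} = (\<lambda>k. (s1 ^^ k) e) ` {..<3}"
    "inj_on (\<lambda>k. (s1 ^^ k) e) {..<3}" "(s1 ^^ 3) e = e"
    using orbit_eq_funpow_image unfolding orb[symmetric] by metis+
qed

lemma funpow_s0:
  assumes "e \<in> edges D" shows "(s0 ^^ k) e \<in> edges D \<and> bend D ((s0 ^^ k) e) = bend D e"
proof -
  have "(s0 ^^ k) e \<in> orbit s0 e"
    by (rule funpow_in_orbit) (simp add: orbit_bsucc[OF dessin] assms)
  then show ?thesis by (simp add: orbit_bsucc[OF dessin] assms)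
qed

lemma funpow_s1:
  assumes "e \<in> edges D" shows "(s1 ^^ k) e \<in> edges D \<and> wend D ((s1 ^^ k) e) = wend D e"
proof -
  have "(s1 ^^ k) e \<in> orbit s1 e"
    by (rule funpow_in_orbit) (simp add: orbit_wsucc[OF dessin] assms)
  then show ?thesis by (simp add: orbit_wsucc[OF dessin] assms)
qed

lemma leaf_edge:
  assumes "e \<in> edges D" "e' \<in> edges D" "bend D e = bend D e'" "deg D (bend D e) = 1"
  shows "e = e'"
proof -
  have "e' \<in> (\<lambda>k. (s0 ^^ k) e) ` {..<1}"
    unfolding orbit_s0(1)[OF assms(1,4), symmetric] using assms by simp
  then show ?thesis by auto
qed

text \<open>This is the use of connectedness: a shortest path between the two vertices passes through no
black leaf, so it has length two.\<close>

lemma common_neighbour: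
  assumes B: "B1 \<in> black D" "B2 \<in> black D" "B1 \<noteq> B2"
    and leaves: "\<And>v. v \<in> black D \<Longrightarrow> v \<noteq> B1 \<Longrightarrow> v \<noteq> B2 \<Longrightarrow> deg D v = 1"
  shows "\<exists>e e'. e \<in> edges D \<and> e' \<in> edges D \<and> bend D e = B1 \<and> bend D e' = B2 \<and> wend D e = wend D e'"
proof (rule ccontr)
  assume neg: "\<not> ?thesis"
  \<comment> \<open>otherwise the vertices at distance at most two from \<open>B1\<close> form a connected component\<close>
  define N where "N = {wend D e |e. e \<in> edges D \<and> bend D e = B1}"
  define X where "X = N \<union> {B1} \<union> {bend D e |e. e \<in> edges D \<and> wend D e \<in> N}"
  have N_white: "N \<subseteq> white D" using dessinD by (auto simp: N_def)
  have "B2 \<notin> X"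
  proof
    assume "B2 \<in> X"
    moreover have "B2 \<notin> N" using B N_white dessinD(4) by blast
    ultimately obtain e where "e \<in> edges D" "wend D e \<in> N" "bend D e = B2"
      using B by (auto simp: X_def)
    moreover then obtain e' where "e' \<in> edges D" "bend D e' = B1" "wend D e' = wend D e"
      by (auto simp: N_def)
    ultimately show False using neg by blast
  qed
  have step: "v \<in> X" if "joins D e u v" "u \<in> X" for e u v
  proof -
    have e: "e \<in> edges D" and "(u = bend D e \<and> v = wend D e) \<or> (u = wend D e \<and> v = bend D e)"
      using that(1) by (auto simp: joins_def doubleton_eq_iff)
    then show ?thesis
    proof (elim disjE conjE)
      assume uv: "u = bend D e" "v = wend D e"
      show ?thesis
      proof (cases "u = B1")
        case True
        then show ?thesis using uv e by (auto simp: X_def N_def)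
      next
        case False
        have u: "u \<in> black D" using uv dessinD(5)[OF e] by simp
        then have "u \<notin> N" using N_white dessinD(4) by auto
        then obtain e' where e': "e' \<in> edges D" "wend D e' \<in> N" "u = bend D e'"
          using False \<open>u \<in> X\<close> by (auto simp: X_def)
        have "u \<noteq> B2" using \<open>B2 \<notin> X\<close> \<open>u \<in> X\<close> by auto
        then have "deg D u = 1" using leaves u False by simp
        then have "e = e'" using leaf_edge[OF e e'(1)] e'(3) uv by simp
        then show ?thesis using e' uv by (simp add: X_def)
      qed
    next
      assume uv: "u = wend D e" "v = bend D e"
      then have "u \<in> white D" using dessinD(6)[OF e] by simp
      then have "u \<notin> black D" using dessinD(4) by auto
      then have "u \<in> N" using \<open>u \<in> X\<close> B(1) dessinD(5) by (auto simp: X_def)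
      then show ?thesis using uv e by (auto simp: X_def)
    qed
  qed
  have "(\<lambda>x y. \<exists>e. joins D e x y)\<^sup>*\<^sup>* B1 B2"
    using dessin B(1,2) unfolding is_dessin_def graph_connected_def vertices_def by simp
  then have "B2 \<in> X"
  proof (induction rule: rtranclp_induct)
    case base
    show ?case by (simp add: X_def)
  next
    case (step u v)
    then show ?case using \<open>\<And>e u v. joins D e u v \<Longrightarrow> u \<in> X \<Longrightarrow> v \<in> X\<close> by blast
  qed
  then show False using \<open>B2 \<notin> X\<close> by blast
qed

text \<open>The edges \<open>e\<close> and \<open>s1 e\<close> join the two black vertices of degree \<open>r\<close> to their common white
neighbour. For \<open>r = 1\<close>, where all black vertices are leaves, any edge will do. For \<open>r \<ge> 2\<close> the white
vertex has degree three, so one of the two edges follows the other, and this edge decides which of the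
two black vertices comes first.\<close>

lemma central_edge:
  obtains e where "e \<in> edges D" "bend D e \<noteq> bend D (s1 e)" "deg D (bend D e) = r"
    "deg D (bend D (s1 e)) = r"
    "\<forall>v \<in> black D. v \<noteq> bend D e \<longrightarrow> v \<noteq> bend D (s1 e) \<longrightarrow> deg D v = 1"
proof (cases "r = 1")
  case True
  have "white D \<noteq> {}" using card_white True by auto
  then obtain w where "w \<in> white D" by blast
  then obtain e where e: "e \<in> edges D"
    using no_isolated_vertex[of w] by (auto simp: vertices_def edges_at_def)
  have s1e: "s1 e \<in> edges D" using funpow_s1[OF e, of 1] by simp
  have deg: "deg D v = 1" if "v \<in> black D" for v using deg_black that True by auto
  have "s1 e \<noteq> e"
    using inj_onD[OF orbit_s1(2)[OF e], of 0 1] by auto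
  then have "bend D e \<noteq> bend D (s1 e)" using leaf_edge[OF e s1e] deg[OF dessinD(5)[OF e]] by metis
  then show ?thesis using that[OF e] deg dessinD(5) e s1e True by auto
next
  case False
  then have r2: "r \<ge> 2" using r by simp
  obtain B1 B2 where B: "B1 \<noteq> B2" "{b \<in> black D. deg D b = r} = {B1, B2}"
    using card_black_r[OF r2] by (auto simp: card_2_iff)
  then have B': "B1 \<in> black D" "B2 \<in> black D" "deg D B1 = r" "deg D B2 = r" by auto
  have leaves: "deg D v = 1" if "v \<in> black D" "v \<noteq> B1" "v \<noteq> B2" for v
    using that B deg_black by blast
  obtain e e' where e: "e \<in> edges D" "e' \<in> edges D" "bend D e = B1" "bend D e' = B2" "wend D e = wend D e'"
    using common_neighbour[OF B'(1,2) B(1) leaves] by blast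
  have "e' \<in> (\<lambda>k. (s1 ^^ k) e) ` {..<3}" using orbit_s1(1)[OF e(1)] e by auto
  then obtain k where k: "e' = (s1 ^^ k) e" "k < 3" by auto
  then consider "k = 0" | "k = 1" | "k = 2" by linarith
  then show ?thesis
  proof cases
    case 1
    then show ?thesis using k e B by auto
  next
    case 2
    then have "s1 e = e'" using k by simp
    then show ?thesis using that[of e] e B B' leaves by auto
  next
    case 3
    then have "s1 e' = (s1 ^^ 3) e" using k by (simp add: numeral_3_eq_3 numeral_2_eq_2)
    then have "s1 e' = e" using orbit_s1(3)[OF e(1)] by simp
    then show ?thesis using that[of e'] e B B' leaves by auto
  qed
qed

end

lemma wreath_act_sigma:
  "wreath_act (wreath_sigma0 r) (0, i) = (0, right_cycle r i)"
  "wreath_act (wreath_sigma0 r) (1, i) = (1, left_cycle r i)"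
  "wreath_act (wreath_sigma0 r) (2, i) = (2, i)"
  "wreath_act wreath_sigma1 (0, i) = (1, i)"
  "wreath_act wreath_sigma1 (1, i) = (2, i)"
  "wreath_act wreath_sigma1 (2, i) = (0, i)"
  by (simp_all only: wreath_sigma0_def wreath_sigma1_def wreath_act_simps id_apply)

text \<open>A parametrization of the edges by three blocks of \<open>2r - 1\<close> points in which the rotations
around the black and the white vertices become \<open>wreath_sigma0 r\<close> and \<open>wreath_sigma1\<close>.\<close>

definition edge_coordinates :: "('v, 'e) dessin \<Rightarrow> nat \<Rightarrow> (nat \<times> nat \<Rightarrow> 'e) \<Rightarrow> bool" where
  "edge_coordinates D r \<beta> \<longleftrightarrow>
     bij_betw \<beta> (wreath_points (2 * r - 1)) (edges D) \<and>
     (\<forall>p \<in> wreath_points (2 * r - 1).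
        bsucc D (\<beta> p) = \<beta> (wreath_act (wreath_sigma0 r) p) \<and>
        wsucc D (\<beta> p) = \<beta> (wreath_act wreath_sigma1 p))"

context passport_tree
begin

text \<open>The white vertices are numbered by \<open>1, \<dots>, 2r - 1\<close>, with the central one at \<open>r\<close>, the other
neighbours of the first black vertex of degree \<open>r\<close> above it and those of the second one below it. The
edge at the first vertex is placed in block 0 and the edge at the second one in block 1; the rotation
around the white vertices determines the rest.\<close>

theorem edge_coordinates_exist:
  obtains \<beta> where "edge_coordinates D r \<beta>"
proof -
  let ?I = "{1..2 * r - 1}" and ?P = "wreath_points (2 * r - 1)"
  obtain e1 where e1: "e1 \<in> edges D" and neq: "bend D e1 \<noteq> bend D (s1 e1)"
    and deg: "deg D (bend D e1) = r" "deg D (bend D (s1 e1)) = r"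
    and leaves: "\<forall>v \<in> black D. v \<noteq> bend D e1 \<longrightarrow> v \<noteq> bend D (s1 e1) \<longrightarrow> deg D v = 1"
    by (rule central_edge)
  define e2 where "e2 = s1 e1"
  have e2: "e2 \<in> edges D" "wend D e2 = wend D e1"
    using funpow_s1[OF e1, of 1] by (simp_all add: e2_def)
  note orb1 = orbit_s0[OF e1 deg(1)] and orb2 = orbit_s0[OF e2(1) deg(2)[folded e2_def]]
  \<comment> \<open>\<open>h i\<close> is the edge that joins the \<open>i\<close>-th white vertex to a black vertex of degree \<open>r\<close>, and \<open>b i\<close> is
    the edge of block 0 at the \<open>i\<close>-th white vertex. For \<open>i < r\<close> the edge \<open>h i\<close> has to lie in block 1, and
    \<open>b i\<close> precedes it, that is, follows it by two steps.\<close>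
  define h where "h i = (if r \<le> i then (s0 ^^ (i - r)) e1 else (s0 ^^ (r - i)) e2)" for i
  define b where "b i = (if r \<le> i then h i else (s1 ^^ 2) (h i))" for i
  define \<beta> where "\<beta> p = (s1 ^^ fst p) (b (snd p))" for p
  have h: "h i \<in> edges D" for i using funpow_s0 e1 e2 by (simp add: h_def)
  have bend_h: "bend D (h i) = bend D (if r \<le> i then e1 else e2)" for i
    using funpow_s0 e1 e2 by (simp add: h_def)
  have b: "b i \<in> edges D" "wend D (b i) = wend D (h i)" for i
    using funpow_s1[OF h] h by (simp_all add: b_def)
  have \<beta>: "\<beta> p \<in> edges D" "wend D (\<beta> p) = wend D (b (snd p))" for p
    using funpow_s1[OF b(1)] by (simp_all add: \<beta>_def)
  have cross: "wend D (h i) \<noteq> wend D (h j)" if ij: "r \<le> i" "j < r" "j \<in> ?I" for i j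
  proof
    assume eq: "wend D (h i) = wend D (h j)"
    have bends: "bend D (h i) = bend D e1" "bend D (h j) = bend D e2" using ij bend_h by auto
    have "wend D e1 = wend D (h j)"
      using no_square[of e1 e2 "h j" "h i"] e1 e2 h eq bends neq by (simp add: e2_def)
    then have "h j = e2"
      using no_parallel_edges[OF h e2(1) bends(2)] e2(2) by simp
    then have "(s0 ^^ (r - j)) e2 = (s0 ^^ 0) e2" using ij by (simp add: h_def)
    moreover have "r - j \<in> {..<r}" "0 \<in> {..<r}" using ij by auto
    ultimately have "r - j = 0" using inj_onD[OF orb2(2)] by blast
    then show False using ij by simp
  qed
  have wend_inj: "inj_on (\<lambda>i. wend D (b i)) ?I"
  proof (rule inj_onI)
    fix i j assume ij: "i \<in> ?I" "j \<in> ?I" and "wend D (b i) = wend D (b j)"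
    then have eq: "wend D (h i) = wend D (h j)" by (simp add: b)
    consider "r \<le> i" "r \<le> j" | "i < r" "j < r" | "r \<le> i" "j < r" | "i < r" "r \<le> j" by linarith
    then show "i = j"
    proof cases
      case 1
      then have "h i = h j" using no_parallel_edges[OF h h _ eq] bend_h by simp
      moreover have "i - r \<in> {..<r}" "j - r \<in> {..<r}" using ij 1 by auto
      ultimately have "i - r = j - r" using 1 inj_onD[OF orb1(2), of "i - r" "j - r"] by (simp add: h_def)
      then show ?thesis using 1 by simp
    next
      case 2
      then have "h i = h j" using no_parallel_edges[OF h h _ eq] bend_h by simp
      moreover have "r - i \<in> {..<r}" "r - j \<in> {..<r}" using ij 2 by auto
      ultimately have "r - i = r - j" using 2 inj_onD[OF orb2(2), of "r - i" "r - j"] by (simp add: h_def)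
      then show ?thesis using 2 by simp
    qed (use cross ij eq in metis)+
  qed
  \<comment> \<open>\<open>2r - 1\<close> distinct white vertices are all of them\<close>
  have wend_surj: "(\<lambda>i. wend D (b i)) ` ?I = white D"
    using dessinD(6)[OF b(1)] card_image[OF wend_inj] card_white
    by (intro card_subset_eq dessinD(2)) auto
  have inj: "inj_on \<beta> ?P"
  proof (rule inj_onI)
    fix p q assume pq: "p \<in> ?P" "q \<in> ?P" and eq: "\<beta> p = \<beta> q"
    then have "wend D (b (snd p)) = wend D (b (snd q))" using \<beta>(2) by metis
    then have snd: "snd p = snd q"
      using pq by (intro inj_onD[OF wend_inj]) (auto simp: wreath_points_def)
    then have "(s1 ^^ fst p) (b (snd p)) = (s1 ^^ fst q) (b (snd p))" using eq by (simp add: \<beta>_def)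
    then have "fst p = fst q"
      using pq by (intro inj_onD[OF orbit_s1(2)[OF b(1)]]) (auto simp: wreath_points_def)
    then show "p = q" using snd by (simp add: prod_eq_iff)
  qed
  have "edges D \<subseteq> \<beta> ` ?P"
  proof
    fix e assume e: "e \<in> edges D"
    then obtain i where i: "i \<in> ?I" "wend D e = wend D (b i)"
      using wend_surj dessinD(6)[OF e] by (metis imageE)
    then have "e \<in> (\<lambda>k. (s1 ^^ k) (b i)) ` {..<3}"
      unfolding orbit_s1(1)[OF b(1), symmetric] using e by simp
    then obtain k where "k < 3" "e = \<beta> (k, i)" by (auto simp: \<beta>_def)
    then show "e \<in> \<beta> ` ?P" using i by (auto simp: wreath_points_def)
  qed
  then have bij: "bij_betw \<beta> ?P (edges D)" using inj \<beta>(1) by (auto simp: bij_betw_def)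
  have s1_cubed: "s1 (s1 (s1 e)) = e" if "e \<in> edges D" for e
    using orbit_s1(3)[OF that] by (simp add: numeral_3_eq_3)
  have white: "s1 (\<beta> p) = \<beta> (wreath_act wreath_sigma1 p)" if "p \<in> ?P" for p
    using that
    by (cases rule: wreath_points_cases)
      (simp_all only: wreath_act_sigma, simp_all add: \<beta>_def s1_cubed b numeral_2_eq_2)
  have \<beta>0: "\<beta> (0, i) = (s0 ^^ (i - r)) e1" if "r \<le> i" for i
    using that by (simp add: \<beta>_def b_def h_def)
  have \<beta>1: "\<beta> (1, i) = (s0 ^^ (r - i)) e2" if "i \<le> r" for i
  proof (cases "i = r")
    case True
    then show ?thesis by (simp add: \<beta>_def b_def h_def e2_def)
  next
    case False
    then have "\<beta> (1, i) = s1 (s1 (s1 (h i)))" using that by (simp add: \<beta>_def b_def numeral_2_eq_2)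
    also have "\<dots> = h i" by (rule s1_cubed[OF h])
    finally show ?thesis using False that by (simp add: h_def)
  qed
  \<comment> \<open>every other edge ends in a black leaf\<close>
  have fixed: "s0 (\<beta> p) = \<beta> p"
    if p: "p \<in> ?P" "\<And>i. r \<le> i \<Longrightarrow> p \<noteq> (0, i)" "\<And>i. i \<le> r \<Longrightarrow> p \<noteq> (1, i)" for p
  proof -
    have "bend D (\<beta> p) \<noteq> bend D e1"
    proof
      assume "bend D (\<beta> p) = bend D e1"
      then have "\<beta> p \<in> (\<lambda>k. (s0 ^^ k) e1) ` {..<r}"
        unfolding orb1(1)[symmetric] using \<beta>(1) by simp
      then obtain k where k: "k < r" "\<beta> p = (s0 ^^ k) e1" by auto
      then have "\<beta> p = \<beta> (0, r + k)" using \<beta>0[of "r + k"] by simp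
      moreover have "(0, r + k) \<in> ?P" using k by (auto simp: wreath_points_def)
      ultimately have "p = (0, r + k)" using inj_onD[OF inj] p(1) by blast
      then show False using p(2)[of "r + k"] by simp
    qed
    moreover have "bend D (\<beta> p) \<noteq> bend D e2"
    proof
      assume "bend D (\<beta> p) = bend D e2"
      then have "\<beta> p \<in> (\<lambda>k. (s0 ^^ k) e2) ` {..<r}"
        unfolding orb2(1)[symmetric] using \<beta>(1) by simp
      then obtain k where k: "k < r" "\<beta> p = (s0 ^^ k) e2" by auto
      then have "\<beta> p = \<beta> (1, r - k)" using \<beta>1[of "r - k"] by simp
      moreover have "(1, r - k) \<in> ?P" using k by (auto simp: wreath_points_def)
      ultimately have "p = (1, r - k)" using inj_onD[OF inj] p(1) by blast
      then show False using p(3)[of "r - k"] by simp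
    qed
    ultimately have "deg D (bend D (\<beta> p)) = 1"
      using leaves[THEN bspec, OF dessinD(5)[OF \<beta>(1)[of p]]] by (simp add: e2_def)
    moreover have "s0 (\<beta> p) \<in> edges D" "bend D (s0 (\<beta> p)) = bend D (\<beta> p)"
      using funpow_s0[OF \<beta>(1), of 1] by simp_all
    ultimately show ?thesis using leaf_edge[OF \<beta>(1)[of p]] by metis
  qed
  have black: "s0 (\<beta> p) = \<beta> (wreath_act (wreath_sigma0 r) p)" if p: "p \<in> ?P" for p
    using p
  proof (cases rule: wreath_points_cases)
    case (1 i)
    then have "1 \<le> i" "i \<le> 2 * r - 1" by simp_all
    then consider "i < r" | "r \<le> i" "i < 2 * r - 1" | "r \<le> i" "i = 2 * r - 1" by linarith
    then have "s0 (\<beta> (0, i)) = \<beta> (0, right_cycle r i)"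
    proof cases
      case 1
      then have "right_cycle r i = i" by (auto simp: right_cycle_def)
      then show ?thesis using fixed[of "(0, i)"] p 1 \<open>p = (0, i)\<close> by simp
    next
      case 2
      then show ?thesis by (simp add: right_cycle_def \<beta>0 Suc_diff_le)
    next
      case 3
      then have "s0 (\<beta> (0, i)) = (s0 ^^ (Suc (i - r))) e1"
        unfolding funpow.simps comp_apply using \<beta>0[of i] by simp
      also have "Suc (i - r) = r" using 3 r by simp
      finally show ?thesis using 3 orb1(3) \<beta>0[of r] by (simp add: right_cycle_def)
    qed
    then show ?thesis unfolding 1(2) wreath_act_sigma .
  next
    case (2 i)
    then have "1 \<le> i" by simp
    then consider "r < i" | "i \<le> r" "1 < i" | "i \<le> r" "i = 1" by linarith
    then have "s0 (\<beta> (1, i)) = \<beta> (1, left_cycle r i)"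
    proof cases
      case 1
      then have "left_cycle r i = i" using r by (auto simp: left_cycle_def)
      then show ?thesis using fixed[of "(1, i)"] p 1 \<open>p = (1, i)\<close> by simp
    next
      case 2
      then have "s0 (\<beta> (1, i)) = (s0 ^^ (Suc (r - i))) e2"
        unfolding funpow.simps comp_apply using \<beta>1[of i] by simp
      also have "Suc (r - i) = r - (i - 1)" using 2 by simp
      finally show ?thesis using 2 \<beta>1[of "i - 1"] by (simp add: left_cycle_def)
    next
      case 3
      then have "s0 (\<beta> (1, i)) = (s0 ^^ (Suc (r - i))) e2"
        unfolding funpow.simps comp_apply using \<beta>1[of i] by simp
      also have "Suc (r - i) = r" using 3 r by simp
      finally show ?thesis using 3 orb2(3) \<beta>1[of r] by (simp add: left_cycle_def)
    qed
    then show ?thesis unfolding 2(2) wreath_act_sigma .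
  next
    case (3 i)
    then show ?thesis using fixed[OF p] unfolding 3(2) wreath_act_sigma by simp
  qed
  have "edge_coordinates D r \<beta>" unfolding edge_coordinates_def using bij black white by simp
  then show ?thesis by (rule that)
qed

theorem monodromy_group_iso:
  assumes l: "labelling D l"
  shows "monodromy_group D l \<cong> (if odd r then wreath_Z3 (alt_group (2 * r - 1)) else R3 r)"
proof -
  let ?n = "card (edges D)"
  obtain \<beta> where "edge_coordinates D r \<beta>" using edge_coordinates_exist .
  then have \<beta>: "bij_betw \<beta> (wreath_points (2 * r - 1)) (edges D)"
    and s0: "\<And>p. p \<in> wreath_points (2 * r - 1) \<Longrightarrow> s0 (\<beta> p) = \<beta> (wreath_act (wreath_sigma0 r) p)"
    and s1: "\<And>p. p \<in> wreath_points (2 * r - 1) \<Longrightarrow> s1 (\<beta> p) = \<beta> (wreath_act wreath_sigma1 p)"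
    unfolding edge_coordinates_def by blast+
  have l': "bij_betw l (edges D) {1..?n}" using l by (simp add: labelling_def)
  have sig0: "sigma0 D l (l e) = l (s0 e)" and sig1: "sigma1 D l (l e) = l (s1 e)" if "e \<in> edges D" for e
    using bij_betw_apply[OF l' that] bij_betw_inv_into_left[OF l' that]
    by (simp_all add: sigma0_def sigma1_def bsucc_def wsucc_def Let_def)
  have "(sym_group ?n)\<lparr>carrier := generate (sym_group ?n) {sigma0 D l, sigma1 D l}\<rparr> \<cong>
      (if odd r then wreath_Z3 (alt_group (2 * r - 1)) else R3 r)"
  proof (rule generate_wreath_perm_iso[OF r])
    show "bij_betw (l \<circ> \<beta>) (wreath_points (2 * r - 1)) {1..?n}" using \<beta> l' by (rule bij_betw_trans)
    fix p assume p: "p \<in> wreath_points (2 * r - 1)"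
    then have "\<beta> p \<in> edges D" using \<beta> bij_betw_apply by metis
    then show "sigma0 D l ((l \<circ> \<beta>) p) = (l \<circ> \<beta>) (wreath_act (wreath_sigma0 r) p)"
      "sigma1 D l ((l \<circ> \<beta>) p) = (l \<circ> \<beta>) (wreath_act wreath_sigma1 p)"
      using sig0 sig1 s0[OF p] s1[OF p] by simp_all
  qed (auto simp: sigma0_def sigma1_def)
  then show ?thesis by (simp add: monodromy_group_def Let_def)
qed

end

theorem passport_trees_isomorphic:
  assumes "passport_tree D r" "passport_tree D' r"
  shows "isomorphic D D'"
proof -
  interpret D: passport_tree D r by fact
  interpret D': passport_tree D' r by fact
  let ?P = "wreath_points (2 * r - 1)"
  obtain \<beta> where "edge_coordinates D r \<beta>" using D.edge_coordinates_exist .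
  then have \<beta>: "bij_betw \<beta> ?P (edges D)"
    and s: "\<And>p. p \<in> ?P \<Longrightarrow> bsucc D (\<beta> p) = \<beta> (wreath_act (wreath_sigma0 r) p)"
      "\<And>p. p \<in> ?P \<Longrightarrow> wsucc D (\<beta> p) = \<beta> (wreath_act wreath_sigma1 p)"
    unfolding edge_coordinates_def by blast+
  obtain \<gamma> where "edge_coordinates D' r \<gamma>" using D'.edge_coordinates_exist .
  then have \<gamma>: "bij_betw \<gamma> ?P (edges D')"
    and t: "\<And>p. p \<in> ?P \<Longrightarrow> bsucc D' (\<gamma> p) = \<gamma> (wreath_act (wreath_sigma0 r) p)"
      "\<And>p. p \<in> ?P \<Longrightarrow> wsucc D' (\<gamma> p) = \<gamma> (wreath_act wreath_sigma1 p)"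
    unfolding edge_coordinates_def by blast+
  define g where "g = \<gamma> \<circ> inv_into ?P \<beta>"
  have g: "bij_betw g (edges D) (edges D')"
    unfolding g_def using bij_betw_inv_into[OF \<beta>] \<gamma> by (rule bij_betw_trans)
  have g\<beta>: "g (\<beta> p) = \<gamma> p" if "p \<in> ?P" for p
    using bij_betw_inv_into_left[OF \<beta> that] by (simp add: g_def)
  have closed: "wreath_act (wreath_sigma0 r) p \<in> ?P" "wreath_act wreath_sigma1 p \<in> ?P" if "p \<in> ?P" for p
    using wreath_act_closed[OF _ that] wreath_sigma_in_carrier[OF D.r] by blast+
  have "g (bsucc D e) = bsucc D' (g e) \<and> g (wsucc D e) = wsucc D' (g e)" if "e \<in> edges D" for e
  proof -
    have "e \<in> \<beta> ` ?P" unfolding bij_betw_imp_surj_on[OF \<beta>] by (rule that)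
    then obtain p where p: "p \<in> ?P" "e = \<beta> p" by blast
    show ?thesis
      unfolding p(2) s[OF p(1)] g\<beta>[OF p(1)] g\<beta>[OF closed(1)[OF p(1)]] g\<beta>[OF closed(2)[OF p(1)]]
        t[OF p(1)] by simp
  qed
  then show ?thesis
    by (intro isomorphicI[OF D.dessin D.no_isolated_vertex D'.dessin D'.no_isolated_vertex g]) simp_all
qed

section \<open>Existence of the tree\<close>

lemma cyclic_on_enumeration:
  assumes "n > 0" and step: "\<And>k. k < n \<Longrightarrow> f (x k) = x (Suc k mod n)"
  shows "cyclic_on f (x ` {..<n})"
proof -
  have pow: "(f ^^ k) (x 0) = x (k mod n)" for k
  proof (induction k)
    case (Suc k)
    then show ?case using step[of "k mod n"] \<open>n > 0\<close> by (simp add: mod_Suc_eq)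
  qed simp
  then have "orbit f (x 0) = {(f ^^ m) (x 0) | m. m < n}"
    using \<open>n > 0\<close> by (intro orbit_altdef_bounded) simp_all
  also have "\<dots> = (\<lambda>m. (f ^^ m) (x 0)) ` {..<n}" by auto
  also have "\<dots> = x ` {..<n}" by (rule image_cong) (simp_all add: pow)
  finally show ?thesis using \<open>n > 0\<close> by (intro cyclic_on_singleI[of "x 0"]) auto
qed

lemma joins_edges_at:
  assumes "joins D e u v" shows "e \<in> edges_at D u" "e \<in> edges_at D v"
  using assms by (auto simp: joins_def edges_at_def doubleton_eq_iff)

text \<open>The bound on the length excludes loops, whose single edge has no companion.\<close>

lemma graph_cycle_two_edges_at:
  assumes cycle: "graph_cycle D vs es" and len: "length es \<ge> 2"
    and e: "e \<in> set es" "e \<in> edges_at D v"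
  shows "\<exists>e' \<in> set es. e' \<noteq> e \<and> e' \<in> edges_at D v"
proof -
  let ?n = "length es"
  have joins: "joins D (es ! i) (vs ! i) (vs ! (Suc i mod ?n))" if "i < ?n" for i
    using cycle that by (simp add: graph_cycle_def)
  have distinct: "distinct es" using cycle by (simp add: graph_cycle_def)
  obtain i where i: "i < ?n" "e = es ! i" using e(1) by (auto simp: in_set_conv_nth)
  have next_neq: "Suc k mod ?n \<noteq> k" if "k < ?n" for k
    using that len by (cases "Suc k = ?n") auto
  have "v = vs ! i \<or> v = vs ! (Suc i mod ?n)"
    using joins[OF i(1)] e(2) unfolding i(2)[symmetric] by (auto simp: joins_def edges_at_def doubleton_eq_iff)
  then show ?thesis
  proof
    assume v: "v = vs ! (Suc i mod ?n)"
    have j: "Suc i mod ?n < ?n" using len by (intro mod_less_divisor) linarith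
    then have "es ! (Suc i mod ?n) \<in> edges_at D v" using joins_edges_at(1)[OF joins[OF j]] v by simp
    moreover have "es ! (Suc i mod ?n) \<noteq> e"
      using nth_eq_iff_index_eq[OF distinct j i(1)] next_neq[OF i(1)] i(2) by simp
    ultimately show ?thesis using j by (metis nth_mem)
  next
    assume v: "v = vs ! i"
    define j where "j = (if i = 0 then ?n - 1 else i - 1)"
    have j: "j < ?n" "Suc j mod ?n = i" using i len by (auto simp: j_def)
    then have "es ! j \<in> edges_at D v" using joins_edges_at(2)[OF joins[OF j(1)]] v by simp
    moreover have "es ! j \<noteq> e"
      using nth_eq_iff_index_eq[OF distinct j(1) i(1)] next_neq[OF j(1)] j(2) i(2) by auto
    ultimately show ?thesis using j by (metis nth_mem)
  qed
qed

text \<open>The edge with coordinates \<open>(c, i)\<close>, where \<open>c < 3\<close> and \<open>1 \<le> i \<le> 2r - 1\<close>, is the number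
\<open>3 i + c\<close>. White vertices are the odd numbers \<open>2 i + 1\<close>. A black vertex is the even number \<open>2 e\<close>, where
\<open>e\<close> is one of its edges: the only edge of a leaf, and the edge \<open>3 r\<close> or \<open>3 r + 1\<close> at the central white
vertex for the two black vertices of degree \<open>r\<close>. For \<open>r = 1\<close> the latter are leaves as well.\<close>

definition standard_tree :: "nat \<Rightarrow> (nat, nat) dessin" where
  "standard_tree r =
     (let hub = (\<lambda>e. if e mod 3 = 0 \<and> r \<le> e div 3 then 3 * r
                     else if e mod 3 = 1 \<and> e div 3 \<le> r then 3 * r + 1 else e) in
     \<lparr>black = (\<lambda>e. 2 * hub e) ` {3..<6 * r}, white = (\<lambda>e. 2 * (e div 3) + 1) ` {3..<6 * r},
      edges = {3..<6 * r}, bend = (\<lambda>e. 2 * hub e), wend = (\<lambda>e. 2 * (e div 3) + 1),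
      rot = (\<lambda>v e. if odd v then 3 * (e div 3) + Suc (e mod 3) mod 3
                   else if e mod 3 = 0 then 3 * right_cycle r (e div 3)
                   else if e mod 3 = 1 then 3 * left_cycle r (e div 3) + 1 else e)\<rparr>)"

context
  fixes r :: nat
  assumes r: "r \<ge> 1"
begin

private abbreviation "T \<equiv> standard_tree r"
private abbreviation "right_edge e \<equiv> e mod 3 = 0 \<and> r \<le> e div 3"
private abbreviation "left_edge e \<equiv> e mod 3 = 1 \<and> e div 3 \<le> r"

private lemma edges_T: "edges T = {3..<6 * r}"
  by (simp add: standard_tree_def Let_def)

private lemma wend_T: "wend T e = 2 * (e div 3) + 1"
  by (simp add: standard_tree_def Let_def)

private lemma bend_T:
  "bend T e = 2 * (if right_edge e then 3 * r else if left_edge e then 3 * r + 1 else e)"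
  by (simp add: standard_tree_def Let_def)

private lemma black_T: "black T = bend T ` edges T" and white_T: "white T = wend T ` edges T"
  by (simp_all add: standard_tree_def Let_def)

private lemma rot_T:
  "rot T v e = (if odd v then 3 * (e div 3) + Suc (e mod 3) mod 3
     else if e mod 3 = 0 then 3 * right_cycle r (e div 3)
     else if e mod 3 = 1 then 3 * left_cycle r (e div 3) + 1 else e)"
  by (simp add: standard_tree_def Let_def)

private lemma bend_neq_wend_T: "bend T e \<noteq> wend T e'" "wend T e' \<noteq> bend T e"
proof -
  have "2 * a \<noteq> 2 * b + (1 :: nat)" for a b by presburger
  then show "bend T e \<noteq> wend T e'" "wend T e' \<noteq> bend T e"
    unfolding bend_T wend_T by metis+
qed

private lemma edges_at_white_T:
  assumes "i \<in> {1..2 * r - 1}"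
  shows "edges_at T (2 * i + 1) = (\<lambda>k. 3 * i + k) ` {..<3}"
proof (intro equalityI subsetI)
  fix e assume "e \<in> edges_at T (2 * i + 1)"
  then have "e div 3 = i"
    using bend_neq_wend_T[of e "3 * i"] by (auto simp: edges_at_def wend_T)
  then have "e = 3 * i + e mod 3" "e mod 3 < 3" by presburger+
  then show "e \<in> (\<lambda>k. 3 * i + k) ` {..<3}" by (intro image_eqI[of _ _ "e mod 3"]) auto
next
  fix e assume "e \<in> (\<lambda>k. 3 * i + k) ` {..<3}"
  then obtain k where "e = 3 * i + k" "k < 3" by auto
  then show "e \<in> edges_at T (2 * i + 1)"
    using assms r by (auto simp: edges_at_def edges_T wend_T)
qed

private lemma edges_at_bend_T: "edges_at T (bend T e) = {e' \<in> edges T. bend T e' = bend T e}"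
  using bend_neq_wend_T by (auto simp: edges_at_def)

private lemma bend_eq_right_T: "bend T e = 6 * r \<longleftrightarrow> right_edge e"
proof (cases "right_edge e \<or> left_edge e")
  case True
  then show ?thesis unfolding bend_T by (elim disjE) simp_all
next
  case False
  then have "bend T e = 2 * e" unfolding bend_T by (simp only: de_Morgan_disj if_False)
  moreover have "e \<noteq> 3 * r" using False by auto
  ultimately show ?thesis using False by simp
qed

private lemma bend_eq_left_T: "bend T e = 6 * r + 2 \<longleftrightarrow> left_edge e"
proof (cases "right_edge e \<or> left_edge e")
  case True
  then show ?thesis unfolding bend_T by (elim disjE) simp_all
next
  case False
  then have "bend T e = 2 * e" unfolding bend_T by (simp only: de_Morgan_disj if_False)
  moreover have "e \<noteq> 3 * r + 1" using False by auto
  ultimately show ?thesis using False by simp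
qed

private lemma right_edges_T: "{e \<in> edges T. right_edge e} = (\<lambda>k. 3 * (r + k)) ` {..<r}"
proof (intro equalityI subsetI)
  fix e assume "e \<in> {e \<in> edges T. right_edge e}"
  then have "e = 3 * (r + (e div 3 - r))" "e div 3 - r \<in> {..<r}" by (auto simp: edges_T)
  then show "e \<in> (\<lambda>k. 3 * (r + k)) ` {..<r}" by (rule image_eqI)
qed (use r in \<open>auto simp: edges_T\<close>)

private lemma left_edges_T: "{e \<in> edges T. left_edge e} = (\<lambda>k. 3 * (r - k) + 1) ` {..<r}"
proof (intro equalityI subsetI)
  fix e assume e: "e \<in> {e \<in> edges T. left_edge e}"
  then have "e div 3 \<ge> 1" "e div 3 \<le> r" "e mod 3 = 1" by (auto simp: edges_T)
  then have "r - (r - e div 3) = e div 3" "r - e div 3 \<in> {..<r}" by auto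
  moreover have "e = 3 * (e div 3) + 1" using \<open>e mod 3 = 1\<close> by presburger
  ultimately have "e = 3 * (r - (r - e div 3)) + 1" "r - e div 3 \<in> {..<r}" by simp_all
  then show "e \<in> (\<lambda>k. 3 * (r - k) + 1) ` {..<r}" by (rule image_eqI)
qed (use r in \<open>auto simp: edges_T\<close>)

private lemma edges_at_right_T: "edges_at T (6 * r) = (\<lambda>k. 3 * (r + k)) ` {..<r}"
proof -
  have hub: "bend T (3 * r) = 6 * r" by (simp add: bend_T)
  have "edges_at T (6 * r) = {e \<in> edges T. right_edge e}"
    using edges_at_bend_T[of "3 * r"] unfolding hub bend_eq_right_T .
  then show ?thesis unfolding right_edges_T .
qed

private lemma edges_at_left_T: "edges_at T (6 * r + 2) = (\<lambda>k. 3 * (r - k) + 1) ` {..<r}"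
proof -
  have hub: "bend T (3 * r + 1) = 6 * r + 2" by (simp add: bend_T)
  have "edges_at T (6 * r + 2) = {e \<in> edges T. left_edge e}"
    using edges_at_bend_T[of "3 * r + 1"] unfolding hub bend_eq_left_T .
  then show ?thesis unfolding left_edges_T .
qed

private lemma edges_at_leaf_T:
  assumes "e \<in> edges T" "\<not> right_edge e" "\<not> left_edge e"
  shows "edges_at T (2 * e) = {e}"
proof -
  have "bend T e = 2 * e" unfolding bend_T using assms by (simp only: if_False)
  then have "edges_at T (2 * e) = {e' \<in> edges T. bend T e' = 2 * e}"
    using edges_at_bend_T[of e] by simp
  also have "\<dots> = {e}"
  proof (intro equalityI subsetI)
    fix e' assume "e' \<in> {e' \<in> edges T. bend T e' = 2 * e}"
    then have "(if right_edge e' then 3 * r else if left_edge e' then 3 * r + 1 else e') = e"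
      by (simp add: bend_T)
    moreover have "e \<noteq> 3 * r" "e \<noteq> 3 * r + 1" using assms(2,3) by auto
    ultimately show "e' \<in> {e}" by (simp split: if_splits)
  qed (use assms(1) \<open>bend T e = 2 * e\<close> in auto)
  finally show ?thesis .
qed

private lemma card_edges_at_T:
  "i \<in> {1..2 * r - 1} \<Longrightarrow> deg T (2 * i + 1) = 3"
  "deg T (6 * r) = r" "deg T (6 * r + 2) = r"
  "e \<in> edges T \<Longrightarrow> \<not> right_edge e \<Longrightarrow> \<not> left_edge e \<Longrightarrow> deg T (2 * e) = 1"
proof -
  show "i \<in> {1..2 * r - 1} \<Longrightarrow> deg T (2 * i + 1) = 3"
    unfolding deg_def edges_at_white_T by (simp add: card_image)
  show "deg T (6 * r) = r"
    unfolding deg_def edges_at_right_T by (simp add: card_image inj_on_def)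
  show "deg T (6 * r + 2) = r"
    unfolding deg_def edges_at_left_T by (subst card_image) (auto simp: inj_on_def)
  show "e \<in> edges T \<Longrightarrow> \<not> right_edge e \<Longrightarrow> \<not> left_edge e \<Longrightarrow> deg T (2 * e) = 1"
    unfolding deg_def by (simp add: edges_at_leaf_T)
qed

private lemma white_T_eq: "white T = (\<lambda>i. 2 * i + 1) ` {1..2 * r - 1}"
proof (intro equalityI subsetI)
  fix v assume "v \<in> white T"
  then obtain e where "e \<in> {3..<6 * r}" "v = 2 * (e div 3) + 1" by (auto simp: white_T wend_T edges_T)
  moreover then have "e div 3 \<in> {1..2 * r - 1}" by auto
  ultimately show "v \<in> (\<lambda>i. 2 * i + 1) ` {1..2 * r - 1}" by blast
next
  fix v assume "v \<in> (\<lambda>i. 2 * i + 1) ` {1..2 * r - 1}"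
  then obtain i where i: "i \<in> {1..2 * r - 1}" "v = 2 * i + 1" by blast
  then have "v = wend T (3 * i)" "3 * i \<in> edges T" using r by (auto simp: wend_T edges_T)
  then show "v \<in> white T" by (simp add: white_T)
qed

text \<open>The edges whose black end is none of the two vertices \<open>6 r\<close> and \<open>6 r + 2\<close>, which have degree
\<open>r\<close>.\<close>

private definition "leaf_edges = {e \<in> edges T. \<not> right_edge e \<and> \<not> left_edge e}"

private lemma black_T_eq: "black T = {6 * r, 6 * r + 2} \<union> (\<lambda>e. 2 * e) ` leaf_edges"
proof (intro equalityI subsetI)
  fix v assume "v \<in> black T"
  then obtain e where "e \<in> edges T" "v = bend T e" by (auto simp: black_T)
  then show "v \<in> {6 * r, 6 * r + 2} \<union> (\<lambda>e. 2 * e) ` leaf_edges"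
    by (auto simp: bend_T leaf_edges_def)
next
  have hubs: "bend T (3 * r) = 6 * r" "bend T (3 * r + 1) = 6 * r + 2" "3 * r \<in> edges T" "3 * r + 1 \<in> edges T"
    using r by (auto simp: bend_T edges_T)
  have "bend T e = 2 * e" if "e \<in> leaf_edges" for e
    using that unfolding bend_T leaf_edges_def by (simp only: mem_Collect_eq if_False)
  then show "v \<in> black T" if "v \<in> {6 * r, 6 * r + 2} \<union> (\<lambda>e. 2 * e) ` leaf_edges" for v
    using that hubs unfolding black_T leaf_edges_def by (auto simp: image_iff) metis+
qed

private lemma card_leaf_edges: "card leaf_edges = 4 * r - 3"
proof -
  let ?R = "(\<lambda>k. 3 * (r + k)) ` {..<r}" and ?L = "(\<lambda>k. 3 * (r - k) + 1) ` {..<r}"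
  have sub: "?R \<subseteq> edges T" "?L \<subseteq> edges T"
    unfolding right_edges_T[symmetric] left_edges_T[symmetric] by blast+
  have "leaf_edges = edges T - (?R \<union> ?L)"
    unfolding leaf_edges_def right_edges_T[symmetric] left_edges_T[symmetric] by auto
  moreover have "?R \<inter> ?L = {}" by (auto, presburger)
  moreover have "card ?R = r" "card ?L = r"
    by (subst card_image; auto simp: inj_on_def)+
  ultimately have "card leaf_edges = card (edges T) - (r + r)"
    using sub by (simp add: card_Diff_subset card_Un_disjoint)
  then show ?thesis by (simp add: edges_T)
qed

lemma passport_standard_tree:
  "passport T = (replicate_mset 2 r + replicate_mset (4 * r - 3) 1, replicate_mset (2 * r - 1) 3)"
proof -
  have "image_mset (deg T) (mset_set (white T)) = image_mset (\<lambda>_. 3) (mset_set (white T))"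
  proof (rule image_mset_cong)
    fix v assume "v \<in># mset_set (white T)"
    then have "v \<in> white T" by (simp add: white_T edges_T)
    then obtain i where "i \<in> {1..2 * r - 1}" "v = 2 * i + 1" unfolding white_T_eq by blast
    then show "deg T v = 3" using card_edges_at_T(1) by simp
  qed
  also have "\<dots> = replicate_mset (2 * r - 1) 3"
    unfolding white_T_eq by (simp add: image_mset_const_eq card_image inj_on_def)
  finally have white: "image_mset (deg T) (mset_set (white T)) = replicate_mset (2 * r - 1) 3" .
  have fin: "finite leaf_edges" by (simp add: leaf_edges_def edges_T)
  have "right_edge (3 * r)" "left_edge (3 * r + 1)" by presburger+
  then have "3 * r \<notin> leaf_edges" "3 * r + 1 \<notin> leaf_edges" unfolding leaf_edges_def by blast+
  moreover have "6 * r = 2 * e \<longleftrightarrow> e = 3 * r" "6 * r + 2 = 2 * e \<longleftrightarrow> e = 3 * r + 1" for e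
    by linarith+
  ultimately have "6 * r \<notin> (\<lambda>e. 2 * e) ` leaf_edges" "6 * r + 2 \<notin> (\<lambda>e. 2 * e) ` leaf_edges"
    unfolding image_iff by metis+
  then have "mset_set (black T) = {#6 * r, 6 * r + 2#} + mset_set ((\<lambda>e. 2 * e) ` leaf_edges)"
    using fin unfolding black_T_eq by simp
  moreover have "image_mset (deg T) (mset_set ((\<lambda>e. 2 * e) ` leaf_edges)) =
      image_mset (\<lambda>_. 1) (mset_set ((\<lambda>e. 2 * e) ` leaf_edges))"
  proof (rule image_mset_cong)
    fix v assume "v \<in># mset_set ((\<lambda>e. 2 * e) ` leaf_edges)"
    then have "v \<in> (\<lambda>e. 2 * e) ` leaf_edges" using fin by simp
    then obtain e where e: "e \<in> leaf_edges" "v = 2 * e" by blast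
    then show "deg T v = 1" using card_edges_at_T(4)[of e] unfolding leaf_edges_def by blast
  qed
  moreover have "\<dots> = replicate_mset (4 * r - 3) 1"
    by (simp add: image_mset_const_eq card_image inj_on_def card_leaf_edges)
  ultimately have "image_mset (deg T) (mset_set (black T)) =
      {#deg T (6 * r), deg T (6 * r + 2)#} + replicate_mset (4 * r - 3) 1"
    by simp
  then have "image_mset (deg T) (mset_set (black T)) = {#r, r#} + replicate_mset (4 * r - 3) 1"
    unfolding card_edges_at_T(2,3) .
  then show ?thesis using white by (simp add: passport_def numeral_2_eq_2)
qed

private lemma cyclic_T:
  assumes "v \<in> vertices T" shows "cyclic_on (rot T v) (edges_at T v)"
proof -
  consider i where "i \<in> {1..2 * r - 1}" "v = 2 * i + 1" | "v = 6 * r" | "v = 6 * r + 2"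
    | e where "e \<in> leaf_edges" "v = 2 * e"
    using assms unfolding vertices_def white_T_eq black_T_eq by blast
  then show ?thesis
  proof cases
    case 1
    then show ?thesis
      unfolding 1(2) edges_at_white_T[OF 1(1)] by (intro cyclic_on_enumeration) (auto simp: rot_T)
  next
    case 2
    have "rot T v (3 * (r + k)) = 3 * (r + Suc k mod r)" if "k < r" for k
    proof (cases "Suc k = r")
      case True
      then have "r + k = 2 * r - 1" by simp
      then show ?thesis using 2 True by (simp add: rot_T right_cycle_def)
    next
      case False
      then show ?thesis using 2 that by (simp add: rot_T right_cycle_def)
    qed
    then show ?thesis using r unfolding 2 edges_at_right_T by (intro cyclic_on_enumeration) auto
  next
    case 3
    have "rot T v (3 * (r - k) + 1) = 3 * (r - Suc k mod r) + 1" if "k < r" for k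
    proof (cases "Suc k = r")
      case True
      then have "r - k = 1" by simp
      then show ?thesis using 3 True by (simp add: rot_T left_cycle_def)
    next
      case False
      then have "left_cycle r (r - k) = r - Suc k" using that by (auto simp: left_cycle_def)
      moreover have "(3 * (r - k) + 1) div 3 = r - k" "(3 * (r - k) + 1) mod 3 = 1" by simp_all
      ultimately show ?thesis using 3 that False by (simp add: rot_T)
    qed
    then show ?thesis using r unfolding 3 edges_at_left_T by (intro cyclic_on_enumeration) auto
  next
    case 4
    then have at: "edges_at T v = {e}" using edges_at_leaf_T by (simp add: leaf_edges_def)
    have e: "e div 3 < r \<or> e mod 3 \<noteq> 0" "r < e div 3 \<or> e mod 3 \<noteq> 1" "e \<in> {3..<6 * r}"
      using 4(1) unfolding leaf_edges_def edges_T by auto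
    have "rot T v e = e"
    proof -
      consider "e mod 3 = 0" "e div 3 < r" | "e mod 3 = 1" "r < e div 3" | "e mod 3 \<notin> {0, 1}"
        using e(1,2) by auto
      then show ?thesis
      proof cases
        case 1
        then have "right_cycle r (e div 3) = e div 3" "3 * (e div 3) = e" by (auto simp: right_cycle_def)
        then show ?thesis using 1 4(2) by (simp add: rot_T)
      next
        case 2
        then have "left_cycle r (e div 3) = e div 3" "3 * (e div 3) + 1 = e"
          using r by (simp_all add: left_cycle_def) presburger
        then show ?thesis using 2 4(2) by (simp add: rot_T)
      next
        case 3
        then show ?thesis using 4(2) by (simp add: rot_T)
      qed
    qed
    then show ?thesis unfolding at cyclic_on_def using orbit_eq_singleton_iff[of "rot T v" e] by simp
  qed
qed

private abbreviation "adj \<equiv> \<lambda>x y. \<exists>e. joins T e x y"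

private lemma adj_ends: "e \<in> edges T \<Longrightarrow> adj\<^sup>*\<^sup>* (bend T e) (wend T e) \<and> adj\<^sup>*\<^sup>* (wend T e) (bend T e)"
proof -
  assume "e \<in> edges T"
  then have "joins T e (bend T e) (wend T e)" "joins T e (wend T e) (bend T e)"
    by (simp_all add: joins_def insert_commute)
  then show ?thesis using r_into_rtranclp[of adj] by blast
qed

private lemma connected_to_center:
  assumes "v \<in> vertices T"
  shows "adj\<^sup>*\<^sup>* v (2 * r + 1) \<and> adj\<^sup>*\<^sup>* (2 * r + 1) v"
proof -
  have white: "adj\<^sup>*\<^sup>* (2 * i + 1) (2 * r + 1) \<and> adj\<^sup>*\<^sup>* (2 * r + 1) (2 * i + 1)"
    if "i \<in> {1..2 * r - 1}" for i
  proof -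
    define c where "c = (if r \<le> i then 0 else 1 :: nat)"
    have "3 * i + c \<in> edges T" "3 * r + c \<in> edges T" using that r by (auto simp: c_def edges_T)
    moreover have "wend T (3 * i + c) = 2 * i + 1" "wend T (3 * r + c) = 2 * r + 1"
      "bend T (3 * i + c) = bend T (3 * r + c)"
      using that by (cases "r \<le> i"; simp add: c_def wend_T bend_T)+
    ultimately have A: "adj\<^sup>*\<^sup>* (2 * i + 1) (bend T (3 * r + c)) \<and> adj\<^sup>*\<^sup>* (bend T (3 * r + c)) (2 * i + 1)"
      and B: "adj\<^sup>*\<^sup>* (2 * r + 1) (bend T (3 * r + c)) \<and> adj\<^sup>*\<^sup>* (bend T (3 * r + c)) (2 * r + 1)"
      using adj_ends[of "3 * i + c"] adj_ends[of "3 * r + c"] by simp_all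
    show ?thesis
      using rtranclp_trans[OF conjunct1[OF A] conjunct2[OF B]]
        rtranclp_trans[OF conjunct1[OF B] conjunct2[OF A]] by (rule conjI)
  qed
  show ?thesis
  proof (cases "v \<in> white T")
    case True
    then obtain i where "i \<in> {1..2 * r - 1}" "v = 2 * i + 1" unfolding white_T_eq by blast
    then show ?thesis using white[of i] by simp
  next
    case False
    then have "v \<in> black T" using assms by (simp add: vertices_def)
    then obtain e where e: "e \<in> edges T" "v = bend T e" unfolding black_T by blast
    then have "wend T e \<in> white T" by (simp add: white_T)
    then obtain i where i: "i \<in> {1..2 * r - 1}" "wend T e = 2 * i + 1" unfolding white_T_eq by blast
    have A: "adj\<^sup>*\<^sup>* v (2 * i + 1) \<and> adj\<^sup>*\<^sup>* (2 * i + 1) v" using adj_ends[OF e(1)] e(2) i(2) by simp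
    show ?thesis
      using rtranclp_trans[OF conjunct1[OF A] conjunct1[OF white[OF i(1)]]]
        rtranclp_trans[OF conjunct2[OF white[OF i(1)]] conjunct2[OF A]] by (rule conjI)
  qed
qed

private lemma is_dessin_T: "is_dessin T"
  unfolding is_dessin_def
proof (intro conjI ballI impI)
  show "finite (vertices T)" "finite (edges T)" by (simp_all add: vertices_def black_T white_T edges_T)
  show "black T \<inter> white T = {}" using bend_neq_wend_T by (auto simp: black_T white_T)
  show "graph_connected T"
    unfolding graph_connected_def
  proof (intro conjI ballI)
    show "vertices T \<noteq> {}" by (simp add: vertices_def black_T_eq)
    fix u v assume "u \<in> vertices T" "v \<in> vertices T"
    then show "adj\<^sup>*\<^sup>* u v" using connected_to_center by (metis rtranclp_trans)
  qed
qed (auto simp: black_T white_T intro: cyclic_T)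

text \<open>On a cycle every vertex has two cycle edges, so no cycle edge ends in a leaf. At a white
vertex other than the central one this leaves a single edge, so all cycle edges are at the central
vertex. The two cycle edges there have different black ends, and neither of these ends
has a second cycle edge.\<close>
private lemma acyclic_T: "\<not> graph_cycle T vs es"
proof
  assume cycle: "graph_cycle T vs es"
  let ?n = "length es"
  let ?C = "set es"
  have C: "?C \<subseteq> edges T"
    using cycle by (auto simp: graph_cycle_def joins_def in_set_conv_nth)
  have n2: "?n \<ge> 2"
  proof (rule ccontr)
    assume "\<not> ?n \<ge> 2"
    then have "?n = 1" using cycle by (cases "length es") (auto simp: graph_cycle_def)
    then have "joins T (es ! 0) (vs ! 0) (vs ! 0)" using cycle by (simp add: graph_cycle_def)
    then show False
      using bend_neq_wend_T[of "es ! 0" "es ! 0"] by (auto simp: joins_def doubleton_eq_iff)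
  qed
  note two = graph_cycle_two_edges_at[OF cycle n2]
  have hub: "right_edge e \<or> left_edge e" if "e \<in> ?C" for e
  proof (rule ccontr)
    assume "\<not> ?thesis"
    then have leaf: "edges_at T (2 * e) = {e}" using edges_at_leaf_T[of e] C that by blast
    then show False using two[OF that, of "2 * e"] by auto
  qed
  have center: "e div 3 = r" if eC: "e \<in> ?C" for e
  proof -
    have "e \<in> edges_at T (wend T e)" using C eC by (auto simp: edges_at_def)
    then obtain e' where e': "e' \<in> ?C" "e' \<noteq> e" "e' \<in> edges_at T (wend T e)" using two[OF eC] by blast
    then have "e' div 3 = e div 3" using bend_neq_wend_T[of e' e] by (auto simp: edges_at_def wend_T)
    moreover have "e' mod 3 \<noteq> e mod 3" using e'(2) calculation by (metis mult_div_mod_eq)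
    ultimately show ?thesis using hub[OF eC] hub[OF e'(1)] by auto
  qed
  have "es \<noteq> []" using cycle by (simp add: graph_cycle_def)
  then obtain e where e: "e \<in> ?C" by (meson hd_in_set)
  have "e \<in> edges_at T (bend T e)" using C e by (auto simp: edges_at_def)
  then obtain e' where e': "e' \<in> ?C" "e' \<noteq> e" "e' \<in> edges_at T (bend T e)" using two[OF e] by blast
  then have "bend T e' = bend T e" using edges_at_bend_T by blast
  moreover have "e' mod 3 \<noteq> e mod 3" using e'(2) center[OF e] center[OF e'(1)] by (metis mult_div_mod_eq)
  ultimately show False
    using hub[OF e] hub[OF e'(1)] by (auto simp: bend_T split: if_splits)
qed

lemma is_tree_standard_tree: "is_tree_dessin T"
  unfolding is_tree_dessin_def using is_dessin_T acyclic_T by blast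

end

section \<open>Uniqueness and the monodromy group\<close>

theorem proposition9:
  fixes r :: nat
  assumes "r \<ge> 1"
  defines "P \<equiv> (replicate_mset 2 r + replicate_mset (4 * r - 3) 1, replicate_mset (2 * r - 1) 3)"
  shows "(\<exists>T :: (nat, nat) dessin. is_tree_dessin T \<and> passport T = P) \<and>
    (\<forall>(D :: ('v, 'e) dessin) (D' :: ('w, 'f) dessin).
       is_tree_dessin D \<and> passport D = P \<and> is_tree_dessin D' \<and> passport D' = P
         \<longrightarrow> isomorphic D D') \<and>
    (\<forall>(D :: ('v, 'e) dessin) l.
       is_tree_dessin D \<and> passport D = P \<and> labelling D l
         \<longrightarrow> (if odd r then monodromy_group D l \<cong> wreath_Z3 (alt_group (2 * r - 1))
              else monodromy_group D l \<cong> R3 r))"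
proof (intro conjI allI impI)
  show "\<exists>T :: (nat, nat) dessin. is_tree_dessin T \<and> passport T = P"
    using is_tree_standard_tree[OF assms(1)] passport_standard_tree[OF assms(1)]
    unfolding P_def by blast
next
  fix D :: "('v, 'e) dessin" and D' :: "('w, 'f) dessin"
  assume "is_tree_dessin D \<and> passport D = P \<and> is_tree_dessin D' \<and> passport D' = P"
  then have "passport_tree D r" "passport_tree D' r"
    using assms(1) unfolding P_def by (simp_all add: passport_tree.intro)
  then show "isomorphic D D'" by (rule passport_trees_isomorphic)
next
  fix D :: "('v, 'e) dessin" and l
  assume D: "is_tree_dessin D \<and> passport D = P \<and> labelling D l"
  then have "passport_tree D r"
    using assms(1) unfolding P_def by (simp add: passport_tree.intro)
  then have "monodromy_group D l \<cong> (if odd r then wreath_Z3 (alt_group (2 * r - 1)) else R3 r)"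
    using D by (intro passport_tree.monodromy_group_iso) simp_all
  then show "if odd r then monodromy_group D l \<cong> wreath_Z3 (alt_group (2 * r - 1))
      else monodromy_group D l \<cong> R3 r"
    by (cases "odd r") simp_all
qed

end
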